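(* For $n=2,3$ and for all $m\geq 4$, the Fadell-Neuwirth pure braid group short exact sequence $$1 \to P_{m-n}(\mathbb{R}P^2\setminus\{x_1,\ldots,x_n\}) \xrightarrow{i_{\ast}} P_m(\mathbb{R}P^2) \xrightarrow{p_{\ast}} P_n(\mathbb{R}P^2) \to 1$$ does not split (that is, there is no group homomorphism $s\colon P_n(\mathbb{R}P^2)\to P_m(\mathbb{R}P^2)$ with $p_\ast\circ s=\mathrm{Id}$).
   Context: For a surface $M$ and $n\geq 1$, $F_n(M)=\{(p_1,\ldots,p_n)\in M^n \mid p_i\neq p_j \text{ if } i\neq j\}$, and $P_n(M)=\pi_1(F_n(M))$ is the $n$th pure braid group of $M$. $\mathbb{R}P^2$ is the real projective plane, and $x_1,\ldots,x_n$ are distinct points of it. The homomorphism $p_\ast$ is induced by the locally trivial fibration $p\colon F_m(\mathbb{R}P^2)\to F_n(\mathbb{R}P^2)$, $p(x_1,\ldots,x_m)=(x_1,\ldots,x_n)$, and $i_\ast$ is induced by the inclusion of the fibre $i\colon F_{m-n}(\mathbb{R}P^2\setminus\{x_1,\ldots,x_n\})\to F_m(\mathbb{R}P^2)$, $i(y_1,\ldots,y_{m-n})=(x_1,\ldots,x_n,y_1,\ldots,y_{m-n})$. The sequence is known to be exact for $m>n\geq 2$. *)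

theory Defs
  imports "HOL-Analysis.Analysis" "HOL-Algebra.Group"
begin

(* The real projective plane: unit sphere of R^3 modulo the antipodal map. *)

quotient_type rp2 = "real^3" / partial: "\<lambda>x y. norm x = 1 \<and> (y = x \<or> y = - x)"
proof (rule part_equivpI)
  show "\<exists>x :: real^3. norm x = 1 \<and> (x = x \<or> x = - x)"
    by (rule exI[of _ "axis 1 1"]) simp
qed (auto intro: sympI transpI)

instantiation rp2 :: topological_space
begin

definition open_rp2 :: "rp2 set \<Rightarrow> bool" where
  "open_rp2 U \<longleftrightarrow> openin (top_of_set (sphere 0 1)) {x \<in> sphere 0 1. abs_rp2 x \<in> U}"

instance
proof
  have "{x \<in> sphere 0 1. abs_rp2 x \<in> UNIV} = topspace (top_of_set (sphere 0 1))"
    by auto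
  then show "open (UNIV :: rp2 set)"
    unfolding open_rp2_def by (simp only: openin_topspace)
next
  fix U V :: "rp2 set"
  assume "open U" "open V"
  moreover have "{x \<in> sphere 0 1. abs_rp2 x \<in> U \<inter> V} =
      {x \<in> sphere 0 1. abs_rp2 x \<in> U} \<inter> {x \<in> sphere 0 1. abs_rp2 x \<in> V}"
    by auto
  ultimately show "open (U \<inter> V)"
    unfolding open_rp2_def by (simp only: openin_Int)
next
  fix K :: "rp2 set set"
  assume K: "\<forall>U\<in>K. open U"
  have "{x \<in> sphere 0 1. abs_rp2 x \<in> \<Union>K} = (\<Union>U\<in>K. {x \<in> sphere 0 1. abs_rp2 x \<in> U})"
    by auto
  with K show "open (\<Union>K)"
    unfolding open_rp2_def by (simp only:) (blast intro: openin_Union)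
qed

end

(* Ordered configurations are functions on {1..n}, set to undefined outside {1..n}; the
   topology is that of a subspace of the product nat => 'a, which on these functions is the
   topology of the n-fold product. *)

definition config_space :: "nat \<Rightarrow> 'a set \<Rightarrow> (nat \<Rightarrow> 'a) set" where
  "config_space n M = {f \<in> {1..n} \<rightarrow>\<^sub>E M. inj_on f {1..n}}"

definition loops_at :: "'a::topological_space set \<Rightarrow> 'a \<Rightarrow> (real \<Rightarrow> 'a) set" where
  "loops_at S a = {p. path p \<and> path_image p \<subseteq> S \<and> pathstart p = a \<and> pathfinish p = a}"

definition fundamental_group :: "'a::topological_space set \<Rightarrow> 'a \<Rightarrow> (real \<Rightarrow> 'a) set monoid" where
  "fundamental_group S a =
     \<lparr>carrier = loops_at S a // {(p, q). homotopic_paths S p q},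
      monoid.mult = (\<lambda>A B. {r. \<exists>p\<in>A. \<exists>q\<in>B. homotopic_paths S (p +++ q) r}),
      one = {r. homotopic_paths S (\<lambda>_. a) r}\<rparr>"

(* The homomorphism induced by f, where T is the codomain of f. *)

definition induced_map ::
  "'b::topological_space set \<Rightarrow> ('a \<Rightarrow> 'b) \<Rightarrow> (real \<Rightarrow> 'a) set \<Rightarrow> (real \<Rightarrow> 'b) set" where
  "induced_map T f A = {q. \<exists>p\<in>A. homotopic_paths T (f \<circ> p) q}"

(* The base point is the configuration (x 1, ..., x n). *)

definition pure_braid_group ::
  "nat \<Rightarrow> 'a::topological_space set \<Rightarrow> (nat \<Rightarrow> 'a) \<Rightarrow> (real \<Rightarrow> nat \<Rightarrow> 'a) set monoid" where
  "pure_braid_group n M x = fundamental_group (config_space n M) (restrict x {1..n})"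

(* The homomorphism on pure braid groups induced by forgetting all but the first n points. *)

definition forget_strands ::
  "nat \<Rightarrow> 'a::topological_space set \<Rightarrow> (real \<Rightarrow> nat \<Rightarrow> 'a) set \<Rightarrow> (real \<Rightarrow> nat \<Rightarrow> 'a) set" where
  "forget_strands n M = induced_map (config_space n M) (\<lambda>f. restrict f {1..n})"

end

theory Submission
  imports Defs
begin

text \<open>
  A loop in the projective plane is orientation preserving iff it lifts to a closed loop in the
  sphere, and this attaches a sign to each strand of a pure braid. The group
  \<open>P\<^sub>2\<close> is the quaternion group of order 8: pairs of distinct lines retract onto pairs of
  perpendicular lines, which are covered by the unit quaternions. Consequently the square of a
  two-strand braid is trivial iff both strands are orientation preserving.

  The half-turns about the axes of an orthonormal frame are pure braids on these axes and generate
  a quaternion group. So a section would give braids \<open>A, B\<close> on at least four strands with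
  \<open>A\<^sup>2 = B\<^sup>2 = (AB)\<^sup>2\<close> and with signs \<open>(+,-)\<close> and \<open>(-,+)\<close> on the first two strands. For any
  two strands the criterion shows that if one of \<open>A, B, AB\<close> preserves both orientations then all
  three do. Comparing strands 3 and 4 with strands 1 and 2, neither \<open>A\<close> nor \<open>B\<close> preserves
  orientation on strand 3 or 4, so \<open>AB\<close> does on both; hence so does \<open>A\<close>, a contradiction.
\<close>

section \<open>Covering spaces and paths\<close>

text \<open>The sign criterion is a statement about monodromy. Following a two-strand braid
  multiplies the unit quaternion above its perpendicular frame by one of the eight units 1, -1, i,
  -i, j, -j, k, -k, and the square of the braid is trivial iff this unit squares to 1. Only 1 and -1
  do, and they are also the only units that keep the directions of both axes. The obstacle is that
  \<open>rp2\<close> is an abstract quotient. Lines are therefore replaced by orthogonal projectors,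
  so that the covering to be lifted has a compact total space and lies over a set of matrices. Pairs
  that are not perpendicular add one contractible parameter, and lifts of single strands to the
  sphere are read off from the lifts of pairs. On the side of the quaternion loops, the 3-sphere is
  simply connected, so that relations between braids reduce to equations between quaternions. Here n
  \<le> 3 enters, since a frame has three axes, while m \<ge> 4 supplies strands 3 and 4. The base
  configuration is arbitrary; the loops are carried to it by conjugation with a path.\<close>

lemma covering_space_finite_action:
  fixes p :: "'a::metric_space \<Rightarrow> 'b::t2_space"
  assumes C: "compact C" and p: "continuous_on C p"
    and G: "finite G" and contG: "\<And>g. g \<in> G \<Longrightarrow> continuous_on C g"
    and bijG: "\<And>g. g \<in> G \<Longrightarrow> bij_betw g C C"
    and fib: "\<And>x y. \<lbrakk>x \<in> C; y \<in> C\<rbrakk> \<Longrightarrow> p x = p y \<longleftrightarrow> (\<exists>g\<in>G. y = g x)"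
    and e: "0 < e" and sep: "\<And>x y. \<lbrakk>x \<in> C; y \<in> C; p x = p y; dist x y < e\<rbrakk> \<Longrightarrow> x = y"
    and free: "\<And>g h x. \<lbrakk>g \<in> G; h \<in> G; x \<in> C; g x = h x\<rbrakk> \<Longrightarrow> g = h"
  shows "covering_space C p (p ` C)"
proof
  have gC: "g x \<in> C" if "g \<in> G" "x \<in> C" for g x
    using bijG[OF that(1)] that(2) by (auto simp: bij_betw_def)
  have pg: "p (g x) = p x" if "g \<in> G" "x \<in> C" for g x
    using fib[OF that(2) gC[OF that]] that(1) by auto
  have openG: "openin (top_of_set C) (C \<inter> g -` U)" if "g \<in> G" "openin (top_of_set C) U" for g U
    using continuous_openin_preimage[OF contG[OF that(1)] _ that(2)] gC[OF that(1)] by blast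
  \<comment> \<open>\<open>V\<close> is the saturation of \<open>U\<close>. The complement of
    \<open>V\<close> is compact, so its image is closed in the Hausdorff target; this makes
    \<open>p\<close> an open map.\<close>
  have opn: "openin (top_of_set (p ` C)) (p ` U)" if U: "openin (top_of_set C) U" for U
  proof -
    have UC: "U \<subseteq> C" using U by (rule openin_imp_subset)
    define V where "V = (\<Union>g\<in>G. C \<inter> g -` U)"
    have V: "V = C \<inter> p -` (p ` U)"
    proof -
      have "y \<in> V" if "y \<in> C" "u \<in> U" "p y = p u" for y u
        using fib[OF that(1), of u] that UC unfolding V_def by fastforce
      moreover have "p y \<in> p ` U" if "y \<in> V" for y
        using that pg unfolding V_def by (auto simp: image_iff) metis
      moreover have "V \<subseteq> C" unfolding V_def by auto
      ultimately show ?thesis by blast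
    qed
    have "openin (top_of_set C) V"
      unfolding V_def using openG[OF _ U] by (intro openin_Union) auto
    then have "closedin (top_of_set C) (C - V)"
      by (simp add: closedin_diff)
    then have "compact (p ` (C - V))"
      using C p by (meson closedin_compact compact_continuous_image continuous_on_subset Diff_subset)
    then have "openin (top_of_set (p ` C)) (p ` C - p ` (C - V))"
      by (metis compact_imp_closed openin_diff closedin_closed_subset openin_subtopology_self
          closed_subset image_mono Diff_subset topspace_euclidean_subtopology closedin_def
            openin_topspace)
    moreover have "p ` C - p ` (C - V) = p ` U"
    proof (intro equalityI subsetI)
      fix y assume "y \<in> p ` U"
      moreover have "x \<in> V" if "x \<in> C" "y = p x" for x
        using that \<open>y \<in> p ` U\<close> unfolding V by simp
      ultimately show "y \<in> p ` C - p ` (C - V)" using UC by blast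
    next
      fix y assume "y \<in> p ` C - p ` (C - V)"
      then obtain x where "x \<in> C" "y = p x" "x \<notin> C - V" by blast
      then show "y \<in> p ` U" unfolding V by simp
    qed
    ultimately show ?thesis by simp
  qed
  show "continuous_on C p" by (rule p)
  show "p ` C = p ` C" ..
  fix y assume "y \<in> p ` C"
  then obtain x where x: "x \<in> C" "y = p x" by auto
  \<comment> \<open>With radius \<open>e/2\<close>, any two points of \<open>U\<close> are closer
    than \<open>e\<close>, so \<open>sep\<close> makes \<open>p\<close> injective on
    \<open>U\<close>.\<close>
  define U where "U = C \<inter> ball x (e/2)"
  have U: "openin (top_of_set C) U"
    unfolding U_def by (simp add: openin_open_Int)
  have UC: "U \<subseteq> C" by (auto simp: U_def)
  have sepU: "u = v" if "u \<in> U" "v \<in> U" "p u = p v" for u v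
  proof (rule sep)
    show "dist u v < e"
      using that dist_triangle_half_r[of x u e v] by (auto simp: U_def)
  qed (use that UC in auto)
  \<comment> \<open>The sheets are preimages of \<open>U\<close> under the members of
    \<open>G\<close>, not images, because \<open>G\<close> is not assumed to be closed under
    inverses.\<close>
  define W where "W g = C \<inter> g -` U" for g
  have WU: "g ` W g = U" if "g \<in> G" for g
  proof -
    have "u \<in> g ` W g" if "u \<in> U" for u
    proof -
      have "u \<in> g ` C"
        using bij_betw_imp_surj_on[OF bijG[OF \<open>g \<in> G\<close>]] UC that by blast
      then show ?thesis using that by (auto simp: W_def)
    qed
    then show ?thesis by (auto simp: W_def)
  qed
  show "\<exists>T. y \<in> T \<and> openin (top_of_set (p ` C)) T \<and>
          (\<exists>v. \<Union>v = C \<inter> p -` T \<and> (\<forall>u\<in>v. openin (top_of_set C) u) \<and>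
             pairwise disjnt v \<and> (\<forall>u\<in>v. \<exists>q. homeomorphism u T p q))"
  proof (intro exI[of _ "p ` U"] exI[of _ "W ` G"] conjI ballI)
    show "y \<in> p ` U" using x e by (auto simp: U_def)
    show "openin (top_of_set (p ` C)) (p ` U)" by (rule opn[OF U])
    have "z \<in> \<Union> (W ` G)" if "z \<in> C" "u \<in> U" "p z = p u" for z u
      using fib[OF that(1), of u] that UC by (auto simp: W_def)
    moreover have "p z \<in> p ` U" if "z \<in> \<Union> (W ` G)" for z
      using that pg by (auto simp: W_def) (metis imageI)
    moreover have "\<Union> (W ` G) \<subseteq> C"
      by (auto simp: W_def)
    ultimately show "\<Union> (W ` G) = C \<inter> p -` (p ` U)"
      by blast
    show "pairwise disjnt (W ` G)"
    proof (clarsimp simp: pairwise_def disjnt_def)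
      fix g h assume gh: "g \<in> G" "h \<in> G" "W g \<noteq> W h"
      show "W g \<inter> W h = {}"
      proof (rule ccontr)
        assume "W g \<inter> W h \<noteq> {}"
        then obtain z where z: "z \<in> C" "g z \<in> U" "h z \<in> U" by (auto simp: W_def)
        then have "g z = h z" using sepU pg gh by simp
        then show False using free z gh by blast
      qed
    qed
  next
    fix u assume "u \<in> W ` G"
    then obtain g where g: "g \<in> G" "u = W g" by auto
    show ou: "openin (top_of_set C) u"
      unfolding g W_def by (rule openG[OF g(1) U])
    show "\<exists>q. homeomorphism u (p ` U) p q"
    proof (rule homeomorphism_injective_open_map[of u p "p ` U"])
      show "continuous_on u p"
        using p ou by (meson continuous_on_subset openin_imp_subset)
      have "p ` W g = p ` g ` W g"
        unfolding image_image using pg[OF g(1)] by (intro image_cong) (auto simp: W_def)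
      then show *: "p ` u = p ` U"
        using WU g by simp
      show "inj_on p u"
      proof (rule inj_onI)
        fix a b assume ab: "a \<in> u" "b \<in> u" "p a = p b"
        then have "g a = g b" using sepU pg g by (auto simp: W_def)
        then show "a = b"
          using bijG[OF g(1)] ab g by (auto simp: W_def bij_betw_def inj_on_def)
      qed
      fix V assume V: "openin (top_of_set u) V"
      then have "openin (top_of_set C) V" using ou by (rule openin_trans)
      then have "openin (top_of_set (p ` C)) (p ` V)" by (rule opn)
      moreover have "p ` V \<subseteq> p ` U" using V * openin_imp_subset by blast
      ultimately show "openin (top_of_set (p ` U)) (p ` V)"
        using opn[OF U] by (meson openin_subset_trans openin_imp_subset)
    qed auto
  qed
qed

text \<open>The source of all homotopies below that are not formal: the two paths are parametrised
  by a simply connected set (an interval, the 3-sphere, or the 3-sphere times an interval), where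
  equal end points suffice.\<close>

lemma homotopic_paths_image_simply_connected:
  fixes U :: "'a::real_normed_vector set"
  assumes "simply_connected U" "continuous_on U f" "f \<in> U \<rightarrow> S"
    and "path p" "path_image p \<subseteq> U" "path q" "path_image q \<subseteq> U"
    and "pathstart p = pathstart q" "pathfinish p = pathfinish q"
  shows "homotopic_paths S (f \<circ> p) (f \<circ> q)"
  using assms
  by (intro homotopic_paths_continuous_image[of U]) (auto simp: simply_connected_eq_homotopic_paths)

section \<open>Conjugating loops by a path\<close>

lemma homotopic_paths_reverse_cancel:
  assumes g: "path g" "path_image g \<subseteq> S" and p: "path p" "path_image p \<subseteq> S"
    and gp: "pathfinish g = pathstart p"
  shows "homotopic_paths S (reversepath g +++ (g +++ p)) p"
proof -
  have P: "path (g +++ p)" "path_image (g +++ p) \<subseteq> S"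
    using assms by (auto simp: path_image_join)
  \<comment> \<open>The left-hand path is \<open>g +++ p\<close> run from parameter 1/2 back to 0,
    forward to 1/2 and on to 1. Inside the unit interval this detour contracts to the segment from
    1/2 to 1, along which \<open>g +++ p\<close> is \<open>p\<close>.\<close>
  let ?l = "linepath (1/2) (0::real) +++ (linepath 0 (1/2) +++ linepath (1/2) 1)"
  have "homotopic_paths S ((g +++ p) \<circ> ?l) ((g +++ p) \<circ> linepath (1/2) 1)"
    using P
    by (intro homotopic_paths_image_simply_connected[of "{0..1::real}"])
      (auto simp: path_def path_image_def[of "g +++ p"] convex_imp_simply_connected path_image_join
        closed_segment_eq_real_ivl intro!: continuous_on_joinpaths)
  moreover have "homotopic_paths S (reversepath g +++ (g +++ p)) ((g +++ p) \<circ> ?l)"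
  proof (rule homotopic_paths_eq)
    fix t :: real assume "t \<in> {0..1}"
    then show "(reversepath g +++ (g +++ p)) t = ((g +++ p) \<circ> ?l) t"
      using gp by (auto simp: joinpaths_def reversepath_def linepath_def pathstart_def pathfinish_def
          algebra_simps diff_divide_distrib)
  qed (use assms in \<open>auto simp: path_image_join\<close>)
  moreover have "homotopic_paths S p ((g +++ p) \<circ> linepath (1/2) 1)"
  proof (rule homotopic_paths_eq)
    fix t :: real assume "t \<in> {0..1}"
    then show "p t = ((g +++ p) \<circ> linepath (1/2) 1) t"
      using gp by (auto simp: joinpaths_def linepath_def pathstart_def pathfinish_def field_simps)
  qed (use assms in auto)
  ultimately show ?thesis
    by (meson homotopic_paths_sym homotopic_paths_trans)
qed

text \<open>Carries a loop based at the end of \<open>g\<close> to its start: from a frame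
  configuration, where the quaternion loops live, to the given base configuration.\<close>

definition conj_path :: "(real \<Rightarrow> 'a::topological_space) \<Rightarrow> (real \<Rightarrow> 'a) \<Rightarrow> real \<Rightarrow> 'a" where
  "conj_path g p = g +++ (p +++ reversepath g)"

lemma conj_path_join:
  assumes g: "path g" "path_image g \<subseteq> S"
    and p: "path p" "path_image p \<subseteq> S" "pathstart p = pathfinish g" "pathfinish p = pathfinish g"
    and q: "path q" "path_image q \<subseteq> S" "pathstart q = pathfinish g" "pathfinish q = pathfinish g"
  shows "homotopic_paths S (conj_path g p +++ conj_path g q) (conj_path g (p +++ q))"
proof -
  let ?r = "reversepath g"
  note [simp] = path_image_join
  have "homotopic_paths S ((g +++ (p +++ ?r)) +++ (g +++ (q +++ ?r))) (g +++ ((p +++ ?r) +++ (g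
    +++ (q +++ ?r))))"
    using assms by (intro homotopic_paths_sym[OF homotopic_paths_assoc]) auto
  also have "homotopic_paths S \<dots> (g +++ (p +++ (?r +++ (g +++ (q +++ ?r)))))"
    using assms by (intro homotopic_paths_join homotopic_paths_sym[OF homotopic_paths_assoc]) auto
  also have "homotopic_paths S \<dots> (g +++ (p +++ (q +++ ?r)))"
    using assms by (intro homotopic_paths_join homotopic_paths_reverse_cancel) auto
  also have "homotopic_paths S \<dots> (g +++ ((p +++ q) +++ ?r))"
    using assms by (intro homotopic_paths_join homotopic_paths_assoc) auto
  finally show ?thesis unfolding conj_path_def .
qed

lemma conj_path_cong:
  assumes "path g" "path_image g \<subseteq> S" "homotopic_paths S p q" "pathstart p = pathfinish g"
    "pathfinish p = pathfinish g"
  shows "homotopic_paths S (conj_path g p) (conj_path g q)"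
  using assms unfolding conj_path_def by (intro homotopic_paths_join) auto

section \<open>The projective plane and lifts to the sphere\<close>

lemma abs_rp2_eq_iff:
  assumes "norm v = 1" "norm w = 1"
  shows "abs_rp2 v = abs_rp2 w \<longleftrightarrow> w = v \<or> w = - v"
proof -
  have "abs_rp2 v = abs_rp2 w \<longleftrightarrow> norm v = 1 \<and> (w = v \<or> w = - v)"
    using Quotient3_rel[OF Quotient3_rp2, of v w] by (simp only: assms simp_thms)
  then show ?thesis
    by (simp only: assms simp_thms)
qed

lemma abs_rp2_minus: "norm v = 1 \<Longrightarrow> abs_rp2 (- v) = abs_rp2 v"
  using abs_rp2_eq_iff[of "- v" v] by (simp add: norm_minus_cancel)

lemma rp2_cases:
  obtains v where "norm v = 1" "x = abs_rp2 v"
proof -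
  have "\<exists>v. norm v = 1 \<and> x = abs_rp2 v"
  proof (induct x rule: rp2.abs_induct)
    fix y :: "real^3" assume "norm y = 1 \<and> (y = y \<or> y = - y)"
    then have "norm y = 1" by (rule conjunct1)
    then show "\<exists>v. norm v = 1 \<and> abs_rp2 y = abs_rp2 v"
      by (intro exI[of _ y]) simp
  qed
  then show ?thesis using that by blast
qed

lemma continuous_on_abs_rp2: "continuous_on (sphere 0 1) abs_rp2"
proof (clarsimp simp: continuous_on_open_invariant)
  fix B :: "rp2 set" assume "open B"
  then have "openin (top_of_set (sphere 0 1)) {x \<in> sphere 0 1. abs_rp2 x \<in> B}"
    by (simp add: open_rp2_def)
  then obtain A where A: "open A" "{x \<in> sphere 0 1. abs_rp2 x \<in> B} = sphere 0 1 \<inter> A"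
    unfolding openin_open by blast
  then have "A \<inter> sphere 0 1 = abs_rp2 -` B \<inter> sphere 0 1"
    by (simp only: set_eq_iff mem_Collect_eq Int_iff vimage_eq) blast
  with A(1) show "\<exists>A. open A \<and> A \<inter> sphere 0 1 = abs_rp2 -` B \<inter> sphere 0 1"
    by blast
qed

lemma continuous_on_rp2:
  fixes f :: "rp2 \<Rightarrow> 'a::topological_space"
  assumes "continuous_on (sphere 0 1) (\<lambda>v. f (abs_rp2 v))"
  shows "continuous_on UNIV f"
proof (subst continuous_on_open_vimage, simp, intro allI impI)
  fix B :: "'a set" assume "open B"
  then have "openin (top_of_set (sphere 0 1)) (sphere 0 1 \<inter> (\<lambda>v. f (abs_rp2 v)) -` B)"
    using assms continuous_openin_preimage_gen by blast
  moreover have "sphere 0 1 \<inter> (\<lambda>v. f (abs_rp2 v)) -` B = {x \<in> sphere 0 1. abs_rp2 x \<in> f -` B}"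
    by auto
  ultimately show "open (f -` B \<inter> UNIV)"
    by (simp add: open_rp2_def)
qed

text \<open>For a unit vector this is the orthogonal projector onto its line. Being quadratic it
  ignores the sign of \<open>v\<close>, and so descends to the projective plane.\<close>

definition outer :: "real^3 \<Rightarrow> real^3^3" where
  "outer v = (\<chi> i j. v $ i * v $ j)"

text \<open>The Frobenius inner product of the two matrices is the square of
  \<open>v \<bullet> w\<close>. If they are equal, this square is 1, and the equality case of
  Cauchy-Schwarz applies.\<close>

lemma outer_eq_imp:
  assumes "outer v = outer w" "norm v = 1" "norm w = 1"
  shows "w = v \<or> w = - v"
proof -
  have *: "v $ i * v $ j = w $ i * w $ j" for i j
    using assms(1) by (simp add: outer_def vec_eq_iff)
  have "(v \<bullet> v) * (v \<bullet> v) = (\<Sum>i\<in>UNIV. \<Sum>j\<in>UNIV. (v $ i * v $ j) * (v $ i * v $ j))"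
    by (simp add: inner_vec_def sum_product ac_simps)
  also have "\<dots> = (\<Sum>i\<in>UNIV. \<Sum>j\<in>UNIV. (v $ i * v $ j) * (w $ i * w $ j))"
    by (simp only: *)
  also have "\<dots> = (v \<bullet> w) * (v \<bullet> w)"
    by (simp add: inner_vec_def sum_product ac_simps)
  finally have "(v \<bullet> v) * (v \<bullet> v) = (v \<bullet> w) * (v \<bullet> w)" .
  moreover have "v \<bullet> v = 1" using assms(2) by (simp add: dot_square_norm)
  ultimately have "(v \<bullet> w) * (v \<bullet> w) = 1" by simp
  then have "v \<bullet> w = 1 \<or> v \<bullet> w = -1"
    using square_eq_1_iff[of "v \<bullet> w"] by simp
  moreover have "w = v" if "v \<bullet> w = 1"
    using that assms(2,3) norm_cauchy_schwarz_eq[of v w] by simp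
  moreover have "- w = v" if "v \<bullet> w = -1"
    using that assms(2,3) norm_cauchy_schwarz_eq[of v "-w"] by simp
  ultimately show ?thesis by auto
qed

lemma outer_minus [simp]: "outer (- v) = outer v"
  by (simp add: outer_def)

lemma continuous_on_outer [continuous_intros]:
  "continuous_on S f \<Longrightarrow> continuous_on S (\<lambda>x. outer (f x))"
  unfolding outer_def by (intro continuous_intros)

text \<open>The choice of representative is harmless because \<open>outer\<close> is even. This
  continuous injection moves arguments about lines into a Euclidean space of matrices, where
  continuity can be checked by formulas.\<close>

definition projector :: "rp2 \<Rightarrow> real^3^3" where
  "projector x = outer (SOME v. norm v = 1 \<and> x = abs_rp2 v)"

lemma projector_abs_rp2:
  assumes "norm v = 1" shows "projector (abs_rp2 v) = outer v"
proof -
  define w where "w = (SOME w. norm w = 1 \<and> abs_rp2 v = abs_rp2 w)"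
  have "norm w = 1 \<and> abs_rp2 v = abs_rp2 w"
    unfolding w_def by (rule someI[of _ v]) (simp add: assms)
  then have "w = v \<or> w = - v"
    using abs_rp2_eq_iff[OF assms, of w] by blast
  then have "outer w = outer v"
    using outer_minus by (elim disjE) simp_all
  then show ?thesis
    unfolding projector_def w_def .
qed

lemma projector_eq_outer_iff:
  assumes "norm v = 1" shows "projector x = outer v \<longleftrightarrow> x = abs_rp2 v"
proof -
  obtain w where w: "norm w = 1" "x = abs_rp2 w"
    using rp2_cases[where x = x] by blast
  show ?thesis
  proof
    assume "projector x = outer v"
    then have "v = w \<or> v = - w"
      using outer_eq_imp[of w v] w assms by (simp add: projector_abs_rp2)
    then show "x = abs_rp2 v"
      using abs_rp2_eq_iff[OF w(1) assms] w(2) by blast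
  qed (simp add: projector_abs_rp2 assms)
qed

lemma continuous_on_projector: "continuous_on UNIV projector"
proof (rule continuous_on_rp2)
  have "continuous_on (sphere 0 1) outer"
    by (intro continuous_intros)
  then show "continuous_on (sphere 0 1) (\<lambda>v. projector (abs_rp2 v))"
    by (rule continuous_on_eq) (simp add: projector_abs_rp2)
qed

section \<open>Lifts to the sphere and the sign of a loop\<close>

lemma norm_path_in_sphere:
  "path_image p \<subseteq> sphere 0 1 \<Longrightarrow> t \<in> {0..1} \<Longrightarrow> norm (p t) = 1"
  by (auto simp: path_image_def image_subset_iff)

text \<open>A relation between end points, as only these decide the sign. Existence of lifts is a
  separate matter: it is derived later from lifts of pairs of strands.\<close>

definition path_lift :: "(real \<Rightarrow> rp2) \<Rightarrow> real^3 \<Rightarrow> real^3 \<Rightarrow> bool" where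
  "path_lift c u v \<longleftrightarrow> (\<exists>w. path w \<and> path_image w \<subseteq> sphere 0 1 \<and> pathstart w = u \<and> pathfinish w = v \<and>
     (\<forall>t\<in>{0..1}. abs_rp2 (w t) = c t))"

lemma path_liftI:
  assumes "path w" "path_image w \<subseteq> sphere 0 1" "\<And>t. t \<in> {0..1} \<Longrightarrow> abs_rp2 (w t) = c t"
  shows "path_lift c (pathstart w) (pathfinish w)"
  using assms unfolding path_lift_def by blast

lemma path_lift_uminus:
  assumes "path_lift c u v"
  shows "path_lift c (- u) (- v)"
proof -
  obtain w where w: "path w" "path_image w \<subseteq> sphere 0 1" "pathstart w = u" "pathfinish w = v"
     "\<forall>t\<in>{0..1}. abs_rp2 (w t) = c t"
    using assms unfolding path_lift_def by blast
  then have "path_lift c (pathstart (\<lambda>t. - w t)) (pathfinish (\<lambda>t. - w t))"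
    by (intro path_liftI)
      (auto simp: path_def path_image_def abs_rp2_minus image_subset_iff intro!: continuous_intros)
  then show ?thesis using w by (simp add: pathstart_def pathfinish_def)
qed

lemma path_lift_join:
  assumes "path_lift c u v" "path_lift d v w"
  shows "path_lift (c +++ d) u w"
proof -
  obtain p q where p: "path p" "path_image p \<subseteq> sphere 0 1" "pathstart p = u" "pathfinish p = v"
     "\<forall>t\<in>{0..1}. abs_rp2 (p t) = c t"
     and q: "path q" "path_image q \<subseteq> sphere 0 1" "pathstart q = v" "pathfinish q = w"
     "\<forall>t\<in>{0..1}. abs_rp2 (q t) = d t"
    using assms unfolding path_lift_def by blast
  have "path_lift (c +++ d) (pathstart (p +++ q)) (pathfinish (p +++ q))"
  proof (rule path_liftI)
    fix t :: real assume "t \<in> {0..1}"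
    then show "abs_rp2 ((p +++ q) t) = (c +++ d) t"
      using p(5) q(5) by (auto simp: joinpaths_def)
  qed (use p q in \<open>auto simp: path_image_join\<close>)
  then show ?thesis using p q by simp
qed

lemma path_lift_reverse:
  assumes "path_lift c u v"
  shows "path_lift (reversepath c) v u"
proof -
  obtain w where w: "path w" "path_image w \<subseteq> sphere 0 1" "pathstart w = u" "pathfinish w = v"
     "\<forall>t\<in>{0..1}. abs_rp2 (w t) = c t"
    using assms unfolding path_lift_def by blast
  then have "path_lift (reversepath c) (pathstart (reversepath w)) (pathfinish (reversepath w))"
    by (intro path_liftI path_reversepath[THEN iffD2]) (auto, simp add: reversepath_def)
  then show ?thesis using w by simp
qed

lemma path_lift_norm:
  assumes "path_lift c u v" shows "norm u = 1" "norm v = 1"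
  using assms unfolding path_lift_def path_image_def pathstart_def pathfinish_def by force+

lemma path_lift_start:
  assumes "path_lift c u v" shows "c 0 = abs_rp2 u" "c 1 = abs_rp2 v"
  using assms unfolding path_lift_def pathstart_def pathfinish_def by force+

lemma path_lift_start_cases:
  assumes "path_lift c u v" "path_lift d w z" "c 0 = d 0"
  shows "w = u \<or> w = - u"
  using abs_rp2_eq_iff[of u w] path_lift_norm[OF assms(1)] path_lift_norm[OF assms(2)]
    path_lift_start[OF assms(1)] path_lift_start[OF assms(2)] assms(3) by simp

lemma path_lift_loop_cases:
  assumes "path_lift c u v" "c 0 = c 1"
  shows "v = u \<or> v = - u"
  using abs_rp2_eq_iff[of u v] path_lift_norm[OF assms(1)] path_lift_start[OF assms(1)] assms(2) by simp

text \<open>Two lifts agree up to sign at each time, so their inner product is continuous with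
  values in {-1, 1} and hence constant. It is 1 at the start.\<close>

lemma path_lift_unique:
  assumes "path_lift c u v" "path_lift c u v'"
  shows "v' = v"
proof -
  obtain p q where p: "path p" "path_image p \<subseteq> sphere 0 1" "pathstart p = u" "pathfinish p = v"
     "\<forall>t\<in>{0..1}. abs_rp2 (p t) = c t"
     and q: "path q" "path_image q \<subseteq> sphere 0 1" "pathstart q = u" "pathfinish q = v'"
     "\<forall>t\<in>{0..1}. abs_rp2 (q t) = c t"
    using assms unfolding path_lift_def by blast
  have n: "norm (p t) = 1" "norm (q t) = 1" if "t \<in> {0..1}" for t
    using that p(2) q(2) by (simp_all add: norm_path_in_sphere)
  have pq: "q t = p t \<or> q t = - p t" if "t \<in> {0..1}" for t
    using n[OF that] p(5) q(5) that abs_rp2_eq_iff[of "p t" "q t"] by simp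
  define f where "f t = p t \<bullet> q t" for t
  have "continuous_on {0..1} f"
    using p(1) q(1) unfolding f_def path_def by (intro continuous_intros)
  then have "connected (f ` {0..1})"
    by (rule connected_continuous_image) simp
  moreover have f: "f t \<in> {-1, 1}" if "t \<in> {0..1}" for t
    using pq[OF that] n[OF that] unfolding f_def by (auto simp: dot_square_norm)
  then have "finite (f ` {0..1})"
    by (meson finite.emptyI finite_insert finite_subset image_subsetI)
  ultimately obtain a where "f ` {0..1} = {a}"
    using connected_finite_iff_sing[of "f ` {0..1}"] by auto
  then have "f 1 = a" "f 0 = a"
    by (auto simp: set_eq_iff image_iff) (metis atLeastAtMost_iff order_refl zero_le_one)+
  then have "f 1 = f 0" by simp
  also have "f 0 = 1"
    using p(3) q(3) n[of 0] by (simp add: f_def pathstart_def dot_square_norm)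
  finally have "f 1 = 1" .
  then show ?thesis
    using norm_cauchy_schwarz_eq[of v v'] n[of 1] p(4) q(4) by (simp add: f_def pathfinish_def)
qed

text \<open>For a loop this is the orientation-preserving sign. One closed lift suffices: by
  uniqueness and the antipodal symmetry every other lift then closes as well.\<close>

definition closed_lift :: "(real \<Rightarrow> rp2) \<Rightarrow> bool" where
  "closed_lift c \<longleftrightarrow> (\<exists>u. path_lift c u u)"

lemma closed_lift_iff:
  assumes c: "path_lift c u v"
  shows "closed_lift c \<longleftrightarrow> u = v"
proof
  assume "closed_lift c"
  then obtain w where w: "path_lift c w w" unfolding closed_lift_def by auto
  then have "w = u \<or> w = - u"
    using path_lift_start_cases[OF c w] by simp
  then have "path_lift c u u"
    using w path_lift_uminus[of c w w] by auto
  then show "u = v" using c path_lift_unique by blast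
qed (use c in \<open>auto simp: closed_lift_def\<close>)

text \<open>The sign is multiplicative: after applying the antipodal map if necessary, the lift of
  \<open>d\<close> starts where the lift of \<open>c\<close> ends.\<close>

lemma closed_lift_join:
  assumes c: "path_lift c u v" and d: "path_lift d w z" and "c 0 = c 1" "c 1 = d 0" "d 0 = d 1"
  shows "closed_lift (c +++ d) \<longleftrightarrow> (closed_lift c \<longleftrightarrow> closed_lift d)"
proof -
  obtain z' where d': "path_lift d v z'"
  proof -
    have "w = u \<or> w = - u" "v = u \<or> v = - u"
      using path_lift_start_cases[OF c d] path_lift_loop_cases[OF c] assms by auto
    then show ?thesis
      using d path_lift_uminus[OF d] that by auto
  qed
  have "v = u \<or> v = - u" "z' = v \<or> z' = - v"
    using path_lift_loop_cases[OF c] path_lift_loop_cases[OF d'] assms by auto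
  moreover have "u \<noteq> 0" using path_lift_norm[OF c] by auto
  ultimately show ?thesis
    using closed_lift_iff[OF c] closed_lift_iff[OF d'] closed_lift_iff[OF path_lift_join[OF c d']]
    by auto
qed

section \<open>Unit quaternions and orthonormal frames\<close>

lemma vector_4:
  "(vector [x, y, z, w] :: 'a::zero^4) $ 1 = x"
  "(vector [x, y, z, w] :: 'a::zero^4) $ 2 = y"
  "(vector [x, y, z, w] :: 'a::zero^4) $ 3 = z"
  "(vector [x, y, z, w] :: 'a::zero^4) $ 4 = w"
  unfolding vector_def by simp_all

lemma continuous_on_vector_3:
  assumes "continuous_on S f" "continuous_on S g" "continuous_on S h"
  shows "continuous_on S (\<lambda>x. vector [f x, g x, h x] :: real^3)"
proof -
  have "\<forall>i. continuous_on S (\<lambda>x. (vector [f x, g x, h x] :: real^3) $ i)"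
    using assms by (simp add: forall_3)
  then have "continuous_on S (\<lambda>x. \<chi> i. (vector [f x, g x, h x] :: real^3) $ i)"
    by (intro continuous_on_vec_lambda) auto
  then show ?thesis by simp
qed

lemma continuous_on_vector_4:
  assumes "continuous_on S f" "continuous_on S g" "continuous_on S h" "continuous_on S k"
  shows "continuous_on S (\<lambda>x. vector [f x, g x, h x, k x] :: real^4)"
proof -
  have "\<forall>i. continuous_on S (\<lambda>x. (vector [f x, g x, h x, k x] :: real^4) $ i)"
    using assms by (simp add: forall_4 vector_4)
  then have "continuous_on S (\<lambda>x. \<chi> i. (vector [f x, g x, h x, k x] :: real^4) $ i)"
    by (intro continuous_on_vec_lambda) auto
  then show ?thesis by simp
qed

text \<open>
  Quaternions are vectors of coordinates with respect to \<open>1, i, j, k\<close>. The maps \<open>quat_i\<close> and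
  \<open>quat_j\<close> multiply by \<open>i\<close> and \<open>j\<close> from the right, and \<open>frame1 q\<close>, \<open>frame2 q\<close>, \<open>frame3 q\<close> are
  \<open>q i q\<^sup>*\<close>, \<open>q j q\<^sup>*\<close>, \<open>q k q\<^sup>*\<close>, viewed as vectors in space.
\<close>

definition quat_i :: "real^4 \<Rightarrow> real^4" where
  "quat_i q = vector [- q $ 2, q $ 1, q $ 4, - q $ 3]"

definition quat_j :: "real^4 \<Rightarrow> real^4" where
  "quat_j q = vector [- q $ 3, - q $ 4, q $ 1, q $ 2]"

definition frame1 :: "real^4 \<Rightarrow> real^3" where
  "frame1 q = vector [(q$1)\<^sup>2 + (q$2)\<^sup>2 - (q$3)\<^sup>2 - (q$4)\<^sup>2, 2 * (q$2 * q$3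
    + q$1 * q$4), 2 * (q$2 * q$4 - q$1 * q$3)]"

definition frame2 :: "real^4 \<Rightarrow> real^3" where
  "frame2 q = vector [2 * (q$2 * q$3 - q$1 * q$4), (q$1)\<^sup>2 - (q$2)\<^sup>2
    + (q$3)\<^sup>2 - (q$4)\<^sup>2, 2 * (q$3 * q$4 + q$1 * q$2)]"

definition frame3 :: "real^4 \<Rightarrow> real^3" where
  "frame3 q = vector [2 * (q$2 * q$4
    + q$1 * q$3), 2 * (q$3 * q$4 - q$1 * q$2), (q$1)\<^sup>2 - (q$2)\<^sup>2 - (q$3)\<^sup>2 + (q$4)\<^sup>2]"

lemmas frame_defs = frame1_def frame2_def frame3_def
lemmas quat_defs = quat_i_def quat_j_def

lemma continuous_on_frame [continuous_intros]:
  assumes "continuous_on S f"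
  shows "continuous_on S (\<lambda>x. frame1 (f x))" "continuous_on S (\<lambda>x. frame2 (f x))"
    "continuous_on S (\<lambda>x. frame3 (f x))"
  unfolding frame_defs by (intro continuous_on_vector_3 continuous_intros assms)+

lemma continuous_on_quat [continuous_intros]:
  assumes "continuous_on S f"
  shows "continuous_on S (\<lambda>x. quat_i (f x))" "continuous_on S (\<lambda>x. quat_j (f x))"
  unfolding quat_defs by (intro continuous_on_vector_4 continuous_intros assms)+

lemma quat_simps [simp]:
  "quat_i (quat_i q) = - q" "quat_j (quat_j q) = - q" "quat_j (quat_i q) = - quat_i (quat_j q)"
  "quat_i (- q) = - quat_i q" "quat_j (- q) = - quat_j q"
  by (simp_all add: quat_defs vec_eq_iff forall_4 vector_4)

lemma inner_quat [simp]:
  "quat_i q \<bullet> quat_i r = q \<bullet> r" "quat_j q \<bullet> quat_j r = q \<bullet> r"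
  "q \<bullet> quat_i q = 0" "q \<bullet> quat_j q = 0" "q \<bullet> quat_i (quat_j q) = 0"
  by (simp_all add: quat_defs inner_vec_def sum_4 vector_4 algebra_simps)

lemma norm_quat [simp]: "norm (quat_i q) = norm q" "norm (quat_j q) = norm q"
  by (simp_all add: norm_eq_sqrt_inner)

lemma frame_quat [simp]:
  "frame1 (- q) = frame1 q" "frame2 (- q) = frame2 q" "frame3 (- q) = frame3 q"
  "frame1 (quat_i q) = frame1 q" "frame2 (quat_i q) = - frame2 q" "frame3 (quat_i q) = - frame3 q"
  "frame1 (quat_j q) = - frame1 q" "frame2 (quat_j q) = frame2 q" "frame3 (quat_j q) = - frame3 q"
  by (simp_all add: frame_defs quat_defs vec_eq_iff forall_3 vector_4 algebra_simps)

lemma inner_frame_aux: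
  "frame1 q \<bullet> frame1 q = (q \<bullet> q)\<^sup>2" "frame2 q \<bullet> frame2 q = (q \<bullet> q)\<^sup>2" "frame3 q \<bullet> frame3 q = (q \<bullet> q)\<^sup>2"
  "frame1 q \<bullet> frame2 q = 0" "frame1 q \<bullet> frame3 q = 0" "frame2 q \<bullet> frame3 q = 0"
  unfolding inner_vec_def sum_3 sum_4 frame_defs vector_3 inner_real_def by algebra+

lemma inner_frame:
  assumes "norm q = 1"
  shows "frame1 q \<bullet> frame1 q = 1" "frame2 q \<bullet> frame2 q = 1" "frame3 q \<bullet> frame3 q = 1"
  "frame1 q \<bullet> frame2 q = 0" "frame1 q \<bullet> frame3 q = 0" "frame2 q \<bullet> frame3 q = 0"
  using assms by (simp_all add: inner_frame_aux dot_square_norm[of q])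

lemma norm_frame:
  assumes "norm q = 1"
  shows "norm (frame1 q) = 1" "norm (frame2 q) = 1" "norm (frame3 q) = 1"
  using assms by (simp_all add: norm_eq_sqrt_inner[of "frame1 q"] norm_eq_sqrt_inner[of "frame2 q"]
    norm_eq_sqrt_inner[of "frame3 q"] inner_frame)

text \<open>Up to sign, the inner products on the right are the coordinates of the quaternion
  \<open>q\<^sup>* r\<close>. For unit \<open>q\<close> and \<open>r\<close> the first two lines are
  the first two diagonal entries of its rotation matrix; the third is multiplicativity of the
  norm.\<close>

lemma inner_frame_frame:
  "frame1 q \<bullet> frame1 r = (q \<bullet> r)\<^sup>2 + (quat_i q \<bullet> r)\<^sup>2 - (quat_j q \<bullet> r)\<^sup>2 - (quat_i (quat_j q) \<bullet> r)\<^sup>2"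
  "frame2 q \<bullet> frame2 r = (q \<bullet> r)\<^sup>2 - (quat_i q \<bullet> r)\<^sup>2 + (quat_j q \<bullet> r)\<^sup>2 - (quat_i (quat_j q) \<bullet> r)\<^sup>2"
  "(q \<bullet> q) * (r \<bullet> r) = (q \<bullet> r)\<^sup>2 + (quat_i q \<bullet> r)\<^sup>2 + (quat_j q \<bullet> r)\<^sup>2 + (quat_i (quat_j q) \<bullet> r)\<^sup>2"
  unfolding inner_vec_def sum_3 sum_4 frame_defs quat_defs vector_3 vector_4 inner_real_def by algebra+

lemma quat_expand:
  "(q \<bullet> q) *\<^sub>R r = (q \<bullet> r) *\<^sub>R q + (quat_i q \<bullet> r) *\<^sub>R quat_i q + (quat_j q \<bullet> r) *\<^sub>R quat_j q
     + (quat_i (quat_j q) \<bullet> r) *\<^sub>R quat_i (quat_j q)"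
  unfolding inner_vec_def sum_4 quat_defs vector_4 inner_real_def vec_eq_iff forall_4
    vector_add_component vector_scaleR_component real_scaleR_def
  by (intro conjI; algebra)

section \<open>The eightfold covering of the pairs of perpendicular lines by the unit
  quaternions\<close>

definition frame_lines :: "real^4 \<Rightarrow> (real^3^3) \<times> (real^3^3)" where
  "frame_lines q = (outer (frame1 q), outer (frame2 q))"

text \<open>Since the squares of the coordinates a, b, c, d of \<open>r\<close> add up to 1, the two
  hypotheses say that a^2 + b^2 and a^2 + c^2 are both 0 or 1. Each of the four combinations leaves
  a single nonzero coordinate, which is 1 or -1.\<close>

lemma frame_fibre:
  assumes q: "norm q = 1" "norm r = 1" and 1: "frame1 q \<bullet> frame1 r \<in> {1, -1}" and
    2: "frame2 q \<bullet> frame2 r \<in> {1, -1}"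
  shows "r \<in> {q, - q, quat_i q, - quat_i q, quat_j q, - quat_j q, quat_i (quat_j q), - quat_i (quat_j q)}"
proof -
  define a where "a = q \<bullet> r"
  define b where "b = quat_i q \<bullet> r"
  define c where "c = quat_j q \<bullet> r"
  define d where "d = quat_i (quat_j q) \<bullet> r"
  have e: "r = a *\<^sub>R q + b *\<^sub>R quat_i q + c *\<^sub>R quat_j q + d *\<^sub>R quat_i (quat_j q)"
    using quat_expand[of q r] q by (simp add: a_def b_def c_def d_def dot_square_norm)
  have n: "a\<^sup>2 + b\<^sup>2 + c\<^sup>2 + d\<^sup>2 = 1"
    using inner_frame_frame(3)[of q r] q by (simp add: a_def b_def c_def d_def dot_square_norm)
  have f: "a\<^sup>2 + b\<^sup>2 - c\<^sup>2 - d\<^sup>2 \<in> {1, -1}" "a\<^sup>2 - b\<^sup>2 + c\<^sup>2 - d\<^sup>2 \<in> {1, -1}"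
    using 1 2 unfolding inner_frame_frame a_def b_def c_def d_def by blast+
  have s: "x\<^sup>2 = 1 \<Longrightarrow> x = 1 \<or> x = -1" for x :: real
    by (simp add: power2_eq_1_iff)
  have z: "x\<^sup>2 = 0 \<Longrightarrow> x = 0" for x :: real
    by simp
  have "a\<^sup>2 = 1 \<and> b\<^sup>2 = 0 \<and> c\<^sup>2 = 0 \<and> d\<^sup>2 = 0 \<or> a\<^sup>2 = 0 \<and> b\<^sup>2 = 1 \<and> c\<^sup>2 = 0 \<and> d\<^sup>2 = 0
    \<or> a\<^sup>2 = 0 \<and> b\<^sup>2 = 0 \<and> c\<^sup>2 = 1 \<and> d\<^sup>2 = 0 \<or> a\<^sup>2 = 0 \<and> b\<^sup>2 = 0 \<and> c\<^sup>2 = 0 \<and> d\<^sup>2 = 1"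
    using n f zero_le_power2[of a] zero_le_power2[of b] zero_le_power2[of c] zero_le_power2[of d]
    unfolding insert_iff empty_iff by argo
  then have "(a = 1 \<or> a = -1) \<and> b = 0 \<and> c = 0 \<and> d = 0 \<or> a = 0 \<and> (b = 1 \<or> b = -1) \<and> c = 0 \<and> d = 0
    \<or> a = 0 \<and> b = 0 \<and> (c = 1 \<or> c = -1) \<and> d = 0 \<or> a = 0 \<and> b = 0 \<and> c = 0 \<and> (d = 1 \<or> d = -1)"
    using s z by blast
  then show ?thesis
    using e by auto
qed

lemma frame_surj1:
  assumes "norm u = 1"
  obtains q where "norm q = 1" "frame1 q = u"
proof -
  have u: "(u$1)\<^sup>2 + (u$2)\<^sup>2 + (u$3)\<^sup>2 = 1"
    using assms by (simp add: norm_eq_sqrt_inner inner_vec_def sum_3 power2_eq_square)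
  show ?thesis
  proof (cases "u $ 1 = -1")
    case True
    then have "u $ 2 = 0" "u $ 3 = 0"
      using u zero_le_power2[of "u$2"] zero_le_power2[of "u$3"] by auto
    then have "frame1 (vector [0, 0, 1, 0]) = u"
      using True by (simp add: frame1_def vec_eq_iff forall_3 vector_4)
    moreover have "norm (vector [0, 0, 1, 0] :: real^4) = 1"
      by (simp add: norm_eq_sqrt_inner inner_vec_def sum_4 vector_4)
    ultimately show ?thesis using that by blast
  next
    case False
    have "\<bar>u $ 1\<bar> \<le> 1" using component_le_norm_cart[of u 1] assms by simp
    with False have pos: "1 + u $ 1 > 0" by auto
    \<comment> \<open>With \<open>u\<close> read as an imaginary quaternion, \<open>k\<close> is the
      norm of 1 - u i, and \<open>q\<close> below is its normalisation, which rotates i to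
      \<open>u\<close>. It degenerates only at u = -i, where the quaternion j was used.\<close>
    define k where "k = sqrt (2 * (1 + u $ 1))"
    have k: "k > 0" "k * k = 2 * (1 + u $ 1)" using pos by (simp_all add: k_def)
    define q where "q = (vector [(1 + u $ 1) / k, 0, - u $ 3 / k, u $ 2 / k] :: real^4)"
    have nn: "(1 + u$1)\<^sup>2 + (u$3)\<^sup>2 + (u$2)\<^sup>2 = k * k"
      unfolding k using u by (simp add: power2_eq_square algebra_simps)
    have "q \<bullet> q = ((1 + u$1)\<^sup>2 + (u$3)\<^sup>2 + (u$2)\<^sup>2) / (k * k)"
      using k(1) by (simp add: q_def inner_vec_def sum_4 vector_4 power2_eq_square field_simps)
    then have "q \<bullet> q = 1" unfolding nn using k(1) by simp
    then have "norm q = 1" by (simp add: norm_eq_sqrt_inner)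
    moreover have "frame1 q = u"
    proof -
      have "frame1 q $ 1 = ((1 + u$1)\<^sup>2 - (u$3)\<^sup>2 - (u$2)\<^sup>2) / (k * k)"
        by (simp add: frame1_def q_def vector_4 power_divide power2_eq_square diff_divide_distrib)
      also have "(1 + u$1)\<^sup>2 - (u$3)\<^sup>2 - (u$2)\<^sup>2 = u $ 1 * (k * k)"
        unfolding k using u by (simp add: power2_eq_square algebra_simps)
      finally have 1: "frame1 q $ 1 = u $ 1" using k(1) by simp
      have "frame1 q $ 2 = u $ 2 * (2 * (1 + u$1)) / (k * k)"
        by (simp add: frame1_def q_def vector_4)
      then have 2: "frame1 q $ 2 = u $ 2" unfolding k(2)[symmetric] using k(1) by simp
      have "frame1 q $ 3 = u $ 3 * (2 * (1 + u$1)) / (k * k)"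
        by (simp add: frame1_def q_def vector_4)
      then have 3: "frame1 q $ 3 = u $ 3" unfolding k(2)[symmetric] using k(1) by simp
      show ?thesis using 1 2 3 by (simp add: vec_eq_iff forall_3)
    qed
    ultimately show ?thesis using that by blast
  qed
qed

lemma frame_expand:
  assumes "norm q = 1"
  shows "v = (frame1 q \<bullet> v) *\<^sub>R frame1 q + (frame2 q \<bullet> v) *\<^sub>R frame2 q + (frame3 q \<bullet> v) *\<^sub>R frame3 q"
proof -
  \<comment> \<open>Homogenised by the fourth power of the norm, completeness of the frame becomes a
    polynomial identity valid for every quaternion.\<close>
  have "(q \<bullet> q)\<^sup>2 *\<^sub>R v = (frame1 q \<bullet> v) *\<^sub>R frame1 q + (frame2 q \<bullet> v) *\<^sub>R frame2 q
    + (frame3 q \<bullet> v) *\<^sub>R frame3 q"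
    unfolding inner_vec_def sum_4 sum_3 frame_defs vector_3 inner_real_def vec_eq_iff forall_3
      vector_add_component vector_scaleR_component real_scaleR_def
    by (intro conjI; algebra)
  then show ?thesis using assms by (simp add: dot_square_norm)
qed

lemma frame_surj:
  assumes u: "norm u = 1" and v: "norm v = 1" and uv: "u \<bullet> v = 0"
  obtains q where "norm q = 1" "frame1 q = u" "frame2 q = v"
proof -
  obtain q where q: "norm q = 1" "frame1 q = u" using frame_surj1[OF u] by blast
  define x where "x = frame2 q \<bullet> v"
  define y where "y = frame3 q \<bullet> v"
  have v': "v = x *\<^sub>R frame2 q + y *\<^sub>R frame3 q"
    using frame_expand[OF q(1), of v] uv q(2) by (simp add: x_def y_def)
  have "v \<bullet> v = x\<^sup>2 + y\<^sup>2"
    unfolding v' using inner_frame[OF q(1)] by (simp add: inner_add_left inner_add_right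
      inner_commute power2_eq_square)
  then have "x\<^sup>2 + y\<^sup>2 = 1" using v by (simp add: dot_square_norm)
  then obtain t where t: "x = cos t" "y = sin t" using sincos_total_2pi by metis
  \<comment> \<open>Right multiplication by cos(t/2) + sin(t/2) i keeps the first axis and turns the
    other two through the angle t; this explains the half angles.\<close>
  define c where "c = cos (t / 2)"
  define s where "s = sin (t / 2)"
  define r where "r = c *\<^sub>R q + s *\<^sub>R quat_i q"
  have cs: "c\<^sup>2 + s\<^sup>2 = 1" by (simp add: c_def s_def)
  have xy: "x = c\<^sup>2 - s\<^sup>2" "y = 2 * s * c"
    unfolding t c_def s_def using cos_double[of "t/2"] sin_double[of "t/2"] by simp_all
  have "r \<bullet> r = c\<^sup>2 + s\<^sup>2"
    unfolding r_def using q(1)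
    by (simp add: inner_add_left inner_add_right inner_commute[of "quat_i q" q] dot_square_norm[of
      q] power2_eq_square)
  then have "norm r = 1" using cs by (simp add: norm_eq_sqrt_inner)
  moreover have "frame1 r = (c\<^sup>2 + s\<^sup>2) *\<^sub>R frame1 q"
    unfolding r_def frame_defs vec_eq_iff forall_3 vector_3 quat_defs vector_4
      vector_add_component vector_scaleR_component real_scaleR_def
    by (intro conjI; algebra)
  moreover have "frame2 r = (c\<^sup>2 - s\<^sup>2) *\<^sub>R frame2 q + (2 * s * c) *\<^sub>R frame3 q"
    unfolding r_def frame_defs vec_eq_iff forall_3 vector_3 quat_defs vector_4
      vector_add_component vector_scaleR_component real_scaleR_def
    by (intro conjI; algebra)
  ultimately show ?thesis
    using that cs xy v' q(2) by simp
qed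

text \<open>The quaternion group of order eight, acting by right multiplication.\<close>

definition frame_deck :: "(real^4 \<Rightarrow> real^4) set" where
  "frame_deck = {\<lambda>q. q, \<lambda>q. - q, \<lambda>q. quat_i q, \<lambda>q. - quat_i q, \<lambda>q. quat_j q, \<lambda>q. - quat_j q,
     \<lambda>q. quat_i (quat_j q), \<lambda>q. - quat_i (quat_j q)}"

lemma frame_deck_props:
  assumes "g \<in> frame_deck"
  shows frame_deck_norm: "norm (g q) = norm q"
    and frame_deck_lines: "frame_lines (g q) = frame_lines q"
    and frame_deck_continuous: "continuous_on S g"
    and frame_deck_fourth: "g (g (g (g q))) = q"
  using assms unfolding frame_deck_def frame_lines_def
  by (elim insertE emptyE; simp add: continuous_intros)+

text \<open>Orders in the quaternion group divide four, so the cube of \<open>g\<close> is its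
  inverse.\<close>

lemma frame_deck_bij:
  assumes "g \<in> frame_deck"
  shows "bij_betw g (sphere 0 1) (sphere 0 1)"
  by (rule bij_betw_byWitness[where f' = "g \<circ> g \<circ> g"])
    (use assms in \<open>auto simp: frame_deck_fourth frame_deck_norm\<close>)

lemma inner_quat_basis:
  assumes "norm x = 1"
  shows "x \<bullet> x = 1" "quat_i x \<bullet> quat_i x = 1" "quat_j x \<bullet> quat_j x = 1"
    "quat_i (quat_j x) \<bullet> quat_i (quat_j x) = 1"
    "quat_i x \<bullet> x = 0" "quat_j x \<bullet> x = 0" "quat_i (quat_j x) \<bullet> x = 0"
    "quat_j x \<bullet> quat_i x = 0" "quat_i x \<bullet> quat_j x = 0"
    "quat_i (quat_j x) \<bullet> quat_i x = 0" "quat_i x \<bullet> quat_i (quat_j x) = 0"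
    "quat_i (quat_j x) \<bullet> quat_j x = 0" "quat_j x \<bullet> quat_i (quat_j x) = 0"
    "x \<bullet> quat_i x = 0" "x \<bullet> quat_j x = 0" "x \<bullet> quat_i (quat_j x) = 0"
proof -
  show 1: "x \<bullet> x = 1" using assms by (simp add: dot_square_norm)
  show "quat_i x \<bullet> quat_i x = 1" "quat_j x \<bullet> quat_j x = 1" "quat_i (quat_j x) \<bullet> quat_i (quat_j x) = 1"
    using 1 by simp_all
qed (simp_all add: quat_defs inner_vec_def sum_4 vector_4 algebra_simps)

text \<open>Up to sign, the eight images of \<open>x\<close> are the members of one orthonormal
  basis, so the four inner products tell them apart.\<close>

lemma frame_deck_free:
  assumes g: "g \<in> frame_deck" and h: "h \<in> frame_deck" and x: "norm x = 1" and gh: "g x = h x"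
  shows "g = h"
proof -
  have *: "x \<bullet> g x = x \<bullet> h x" "quat_i x \<bullet> g x = quat_i x \<bullet> h x" "quat_j x \<bullet> g x = quat_j x \<bullet> h x"
    "quat_i (quat_j x) \<bullet> g x = quat_i (quat_j x) \<bullet> h x"
    using gh by simp_all
  note b = inner_quat_basis[OF x] inner_minus_right
  show ?thesis
    using g h * unfolding frame_deck_def
    by (elim insertE emptyE; simp only: b; simp)
qed

lemma frame_lines_eq_iff:
  assumes q: "norm q = 1" and r: "norm r = 1"
  shows "frame_lines q = frame_lines r \<longleftrightarrow> (\<exists>g\<in>frame_deck. r = g q)"
proof
  assume "frame_lines q = frame_lines r"
  then have "frame1 r = frame1 q \<or> frame1 r = - frame1 q" "frame2 r = frame2 q \<or> frame2 r = - frame2 q"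
    using outer_eq_imp[of "frame1 q" "frame1 r"] outer_eq_imp[of "frame2 q" "frame2 r"]
      norm_frame[OF q] norm_frame[OF r] by (simp_all add: frame_lines_def)
  then have "frame1 q \<bullet> frame1 r \<in> {1, -1}" "frame2 q \<bullet> frame2 r \<in> {1, -1}"
    using inner_frame[OF q] by auto
  from frame_fibre[OF q r this] show "\<exists>g\<in>frame_deck. r = g q"
    unfolding frame_deck_def by auto
qed (auto simp: frame_deck_lines)

lemma covering_space_frame_lines:
  "covering_space (sphere 0 1) frame_lines (frame_lines ` sphere 0 1)"
proof (rule covering_space_finite_action[where G = frame_deck and e = 1])
  show "continuous_on (sphere 0 1) frame_lines"
    unfolding frame_lines_def by (intro continuous_intros)
  show "finite frame_deck"
    by (simp add: frame_deck_def)
  show "frame_lines q = frame_lines r \<longleftrightarrow> (\<exists>g\<in>frame_deck. r = g q)"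
    if "q \<in> sphere 0 1" "r \<in> sphere 0 1" for q r
    using frame_lines_eq_iff that by simp
  show "q = r" if qr: "q \<in> sphere 0 1" "r \<in> sphere 0 1" "frame_lines q = frame_lines r"
    "dist q r < 1" for q r
  proof -
    have n: "norm q = 1" "norm r = 1" using qr by auto
    then obtain g where g: "g \<in> frame_deck" "r = g q" using qr(3) frame_lines_eq_iff by blast
    \<comment> \<open>Distinct points of a fibre are orthogonal or antipodal, whereas unit vectors
      at distance less than 1 have positive inner product. So \<open>e = 1\<close> separates the
      fibres.\<close>
    have "q = r \<or> q \<bullet> r \<le> 0"
      using g inner_quat_basis[OF n(1)] unfolding frame_deck_def
      by (elim insertE emptyE) simp_all
    moreover have "q \<bullet> r > 0"
    proof -
      have "(dist q r)\<^sup>2 < 1\<^sup>2" using qr(4) by (intro power_strict_mono) auto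
      moreover have "(dist q r)\<^sup>2 = q \<bullet> q + r \<bullet> r - 2 * (q \<bullet> r)"
        unfolding dist_norm power2_norm_eq_inner by (simp add: inner_diff_left inner_diff_right
          inner_commute)
      ultimately show ?thesis using n by (simp add: dot_square_norm)
    qed
    ultimately show ?thesis by auto
  qed
  show "g = h" if "g \<in> frame_deck" "h \<in> frame_deck" "x \<in> sphere 0 1" "g x = h x" for g h x
    using frame_deck_free that by auto
qed (auto simp: frame_deck_bij frame_deck_continuous)

section \<open>Pairs of distinct lines\<close>

definition perp :: "real^3 \<Rightarrow> real^3 \<Rightarrow> real^3" where
  "perp u v = v - (u \<bullet> v) *\<^sub>R u"

text \<open>Gram-Schmidt in terms of projectors: for \<open>A = outer u\<close> and
  \<open>B = outer v\<close> the result is the rank-one matrix of \<open>perp u v\<close>, and its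
  trace is the squared norm by which to divide.\<close>

definition compress :: "real^3^3 \<Rightarrow> real^3^3 \<Rightarrow> real^3^3" where
  "compress A B = (mat 1 - A) ** B ** (mat 1 - A)"

lemma compress_outer: "compress (outer u) (outer v) = outer (perp u v)"
  unfolding compress_def perp_def outer_def matrix_matrix_mult_def mat_def vec_eq_iff forall_3 sum_3
    inner_vec_def inner_real_def
  by (simp add: algebra_simps)

lemma trace_outer: "trace (outer v) = v \<bullet> v"
  by (simp add: trace_def outer_def inner_vec_def)

lemma outer_scaleR: "outer (c *\<^sub>R v) = (c * c) *\<^sub>R outer v"
  by (simp add: outer_def vec_eq_iff algebra_simps)

lemma outer_mult_vec: "outer v *v w = (v \<bullet> w) *\<^sub>R v"
  by (simp add: outer_def matrix_vector_mult_def inner_vec_def vec_eq_iff sum_3 algebra_simps)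

text \<open>
  The retraction of pairs of distinct lines onto pairs of perpendicular lines, the lines being
  encoded by their orthogonal projectors: the Gram--Schmidt process, written in terms of
  projectors so that it does not depend on the choice of unit vectors.
\<close>

definition pair_lines :: "rp2 \<times> rp2 \<Rightarrow> (real^3^3) \<times> (real^3^3)" where
  "pair_lines z = (projector (fst z),
     (1 / trace (compress (projector (fst z)) (projector (snd z)))) *\<^sub>R compress (projector (fst z))
       (projector (snd z)))"

definition distinct_pairs :: "(rp2 \<times> rp2) set" where
  "distinct_pairs = {z. fst z \<noteq> snd z}"

lemma perp_nonzero:
  assumes "norm u = 1" "norm v = 1" "abs_rp2 u \<noteq> abs_rp2 v"
  shows "perp u v \<noteq> 0"
proof
  assume "perp u v = 0"
  then have v: "v = (u \<bullet> v) *\<^sub>R u" by (simp add: perp_def)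
  then have "norm v = \<bar>u \<bullet> v\<bar> * norm u" by (metis norm_scaleR)
  then have "u \<bullet> v = 1 \<or> u \<bullet> v = -1" using assms by auto
  then have "v = u \<or> v = - u"
    using v by (elim disjE) (metis scaleR_one, metis scaleR_minus1_left)
  then show False using assms abs_rp2_eq_iff by blast
qed

lemma pair_lines_abs_rp2:
  assumes "norm u = 1" "norm v = 1"
  shows "pair_lines (abs_rp2 u, abs_rp2 v) = (outer u, outer (perp u v /\<^sub>R norm (perp u v)))"
  using assms
  by (simp add: pair_lines_def projector_abs_rp2 compress_outer trace_outer outer_scaleR dot_square_norm
      power2_eq_square field_simps)

lemma continuous_on_compress:
  assumes f: "continuous_on S f" and g: "continuous_on S g"
  shows "continuous_on S (\<lambda>x. compress (f x) (g x))"
proof -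
  have m: "continuous_on S (\<lambda>x. a x ** b x)" if "continuous_on S a" "continuous_on S b" for a b
    :: "'a \<Rightarrow> real^3^3"
    unfolding matrix_matrix_mult_def by (intro continuous_intros that)
  show ?thesis
    unfolding compress_def by (intro m continuous_intros f g)
qed

lemma continuous_on_pair_lines: "continuous_on distinct_pairs pair_lines"
proof -
  have pr: "continuous_on S (\<lambda>z. projector (f z))" if "continuous_on S f" for S :: "(rp2 \<times> rp2) set"
    and f
    by (rule continuous_on_compose2[OF continuous_on_projector that]) simp
  have c: "continuous_on distinct_pairs (\<lambda>z. compress (projector (fst z)) (projector (snd z)))"
    by (intro continuous_on_compress pr continuous_on_fst continuous_on_snd continuous_on_id)
  have t: "continuous_on distinct_pairs (\<lambda>z. trace (compress (projector (fst z)) (projector (snd z))))"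
    unfolding trace_def by (intro continuous_intros c)
  have nz: "trace (compress (projector (fst z)) (projector (snd z))) \<noteq> 0" if "z \<in> distinct_pairs" for z
  proof -
    obtain u v where uv: "norm u = 1" "norm v = 1" "fst z = abs_rp2 u" "snd z = abs_rp2 v"
      using rp2_cases by metis
    have "perp u v \<noteq> 0" using perp_nonzero[OF uv(1,2)] that uv by (simp add: distinct_pairs_def)
    then show ?thesis using uv by (simp add: projector_abs_rp2 compress_outer trace_outer)
  qed
  show ?thesis
    unfolding pair_lines_def
    by (intro continuous_on_Pair continuous_on_scaleR continuous_on_divide continuous_on_const c t pr
        continuous_on_fst continuous_on_id) (use nz in auto)
qed

text \<open>
  The universal covering of the space of pairs of distinct lines; the real parameter is the cosine
  of the angle between the two unit vectors.
\<close>

definition pair_of :: "(real^4) \<times> real \<Rightarrow> rp2 \<times> rp2" where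
  "pair_of z = (abs_rp2 (frame1 (fst z)), abs_rp2 (snd z *\<^sub>R frame1 (fst z)
    + sqrt (1 - (snd z)\<^sup>2) *\<^sub>R frame2 (fst z)))"

lemma frame_comb:
  assumes "norm q = 1" "\<bar>s\<bar> < 1"
  shows "norm (s *\<^sub>R frame1 q + sqrt (1 - s\<^sup>2) *\<^sub>R frame2 q) = 1"
    and "frame1 q \<bullet> (s *\<^sub>R frame1 q + sqrt (1 - s\<^sup>2) *\<^sub>R frame2 q) = s"
    and "sqrt (1 - s\<^sup>2) > 0"
proof -
  have "s\<^sup>2 < 1" using assms by (simp add: abs_square_less_1)
  then show "sqrt (1 - s\<^sup>2) > 0" by simp
  have "(s *\<^sub>R frame1 q + sqrt (1 - s\<^sup>2) *\<^sub>R frame2 q) \<bullet> (s *\<^sub>R frame1 q + sqrt (1 - s\<^sup>2) *\<^sub>R frame2 q) =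
      s * s + sqrt (1 - s\<^sup>2) * sqrt (1 - s\<^sup>2)"
    using inner_frame[OF assms(1)] by (simp add: inner_add_left inner_add_right inner_commute[of
      "frame2 q" "frame1 q"])
  also have "\<dots> = 1" using \<open>s\<^sup>2 < 1\<close> by (simp add: power2_eq_square)
  finally show "norm (s *\<^sub>R frame1 q + sqrt (1 - s\<^sup>2) *\<^sub>R frame2 q) = 1"
    by (simp add: norm_eq_sqrt_inner)
  show "frame1 q \<bullet> (s *\<^sub>R frame1 q + sqrt (1 - s\<^sup>2) *\<^sub>R frame2 q) = s"
    using inner_frame[OF assms(1)] by (simp add: inner_add_right)
qed

lemma pair_of_distinct:
  assumes "norm q = 1" "\<bar>s\<bar> < 1"
  shows "pair_of (q, s) \<in> distinct_pairs"
proof -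
  let ?v = "s *\<^sub>R frame1 q + sqrt (1 - s\<^sup>2) *\<^sub>R frame2 q"
  have "?v \<noteq> frame1 q" "?v \<noteq> - frame1 q"
    using frame_comb(2)[OF assms] inner_frame(1)[OF assms(1)] assms(2)
    by (metis abs_one less_irrefl, metis abs_minus_cancel abs_one inner_minus_right less_irrefl)
  then show ?thesis
    using abs_rp2_eq_iff[OF norm_frame(1)[OF assms(1)] frame_comb(1)[OF assms]]
    by (simp add: pair_of_def distinct_pairs_def)
qed

lemma continuous_on_pair_of: "continuous_on (sphere 0 1 \<times> {-1<..<1}) pair_of"
  unfolding pair_of_def
  by (intro continuous_on_Pair continuous_on_compose2[OF continuous_on_abs_rp2] continuous_intros)
    (auto simp: norm_frame frame_comb(1) abs_less_iff)

lemma pair_lines_surj: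
  assumes "z \<in> distinct_pairs"
  shows "pair_lines z \<in> frame_lines ` sphere 0 1"
proof -
  obtain u v where uv: "norm u = 1" "norm v = 1" "z = (abs_rp2 u, abs_rp2 v)"
    using rp2_cases by (metis prod.exhaust)
  have nz: "perp u v \<noteq> 0" using perp_nonzero[OF uv(1,2)] assms uv by (simp add: distinct_pairs_def)
  have "u \<bullet> perp u v = 0" using uv(1) by (simp add: perp_def inner_diff_right dot_square_norm)
  then obtain q where "norm q = 1" "frame1 q = u" "frame2 q = perp u v /\<^sub>R norm (perp u v)"
    using frame_surj[of u "perp u v /\<^sub>R norm (perp u v)"] uv(1) nz by auto
  then show ?thesis
    using pair_lines_abs_rp2[OF uv(1,2)] uv(3) by (intro image_eqI[of _ _ q]) (auto
      simp: frame_lines_def)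
qed

text \<open>Over a fixed frame the second line lies in the plane of the first two axes and differs
  from the first axis, so it is given by a cosine \<open>s\<close> in the open interval. The last
  two equations see the line only through its projector; they serve to recover \<open>s\<close>
  continuously.\<close>

lemma pair_of_cases:
  assumes z: "z \<in> distinct_pairs" and q: "norm q = 1" and zq: "pair_lines z = frame_lines q"
  obtains s where "\<bar>s\<bar> < 1" "z = pair_of (q, s)"
    "frame1 q \<bullet> (projector (snd z) *v frame2 q) = s * sqrt (1 - s\<^sup>2)"
    "frame2 q \<bullet> (projector (snd z) *v frame2 q) = 1 - s\<^sup>2"
proof -
  obtain v0 where v0: "norm v0 = 1" "snd z = abs_rp2 v0" using rp2_cases[where x = "snd z"] by blast
  define u where "u = frame1 q"
  have u: "norm u = 1" using norm_frame[OF q] by (simp add: u_def)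
  have "projector (fst z) = outer u" using zq by (simp add: pair_lines_def frame_lines_def u_def)
  then have fz: "fst z = abs_rp2 u" using projector_eq_outer_iff[OF u] by simp
  have "outer (perp u v0 /\<^sub>R norm (perp u v0)) = outer (frame2 q)"
    using pair_lines_abs_rp2[OF u v0(1)] zq fz v0(2) by (metis frame_lines_def prod.collapse snd_conv)
  moreover have nz0: "perp u v0 \<noteq> 0" using perp_nonzero[OF u v0(1)] z fz v0 by (simp
    add: distinct_pairs_def)
  ultimately have "frame2 q = perp u v0 /\<^sub>R norm (perp u v0) \<or> frame2 q
    = - (perp u v0 /\<^sub>R norm (perp u v0))"
    using outer_eq_imp[of "perp u v0 /\<^sub>R norm (perp u v0)" "frame2 q"] norm_frame(2)[OF q] by simp
  moreover have "perp u (- v0) = - perp u v0" by (simp add: perp_def)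
  \<comment> \<open>Of the two unit vectors on the second line, \<open>v\<close> is the one with
    positive component along \<open>frame2 q\<close>.\<close>
  ultimately obtain v where v: "norm v = 1" "snd z = abs_rp2 v"
    "frame2 q = perp u v /\<^sub>R norm (perp u v)" "perp u v \<noteq> 0"
    using v0 nz0 abs_rp2_minus[OF v0(1)] by (metis norm_minus_cancel scaleR_minus_right
      neg_equal_0_iff_equal)
  define s where "s = u \<bullet> v"
  define k where "k = norm (perp u v)"
  have k: "k > 0" using v(4) by (simp add: k_def)
  have vs: "v = s *\<^sub>R u + k *\<^sub>R frame2 q"
    using v(3,4) by (simp add: s_def k_def perp_def)
  have "v \<bullet> v = s\<^sup>2 + k\<^sup>2"
    unfolding vs u_def using inner_frame[OF q]
    by (simp add: inner_add_left inner_add_right inner_commute[of "frame2 q" "frame1 q"]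
      power2_eq_square)
  then have sk: "s\<^sup>2 + k\<^sup>2 = 1" using v(1) by (simp add: dot_square_norm)
  then have k': "k = sqrt (1 - s\<^sup>2)" using k by (intro real_sqrt_unique[symmetric]) auto
  have "s\<^sup>2 < 1" using sk k by (smt (verit) zero_less_power)
  then have "\<bar>s\<bar> < 1" by (simp add: abs_square_less_1)
  moreover have "z = pair_of (q, s)"
    using fz v(2) vs unfolding u_def k' by (simp add: pair_of_def prod_eq_iff)
  moreover have "projector (snd z) *v frame2 q = k *\<^sub>R v"
  proof -
    have "v \<bullet> frame2 q = k" unfolding vs u_def using inner_frame[OF q] by (simp add: inner_add_left)
    then show ?thesis using v(1,2) by (simp add: projector_abs_rp2 outer_mult_vec)
  qed
  then have "frame1 q \<bullet> (projector (snd z) *v frame2 q) = s * k"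
    "frame2 q \<bullet> (projector (snd z) *v frame2 q) = k * k"
    unfolding vs u_def using inner_frame[OF q] by (simp_all add: inner_add_right inner_commute[of
      "frame2 q" "frame1 q"])
  moreover have "k * k = 1 - s\<^sup>2" using sk by (simp add: power2_eq_square)
  ultimately show ?thesis using that k' by simp
qed

section \<open>Path lifting for pairs of lines\<close>

lemma continuous_on_projector_vec:
  assumes "continuous_on S f" "continuous_on S g" "continuous_on S h"
  shows "continuous_on S (\<lambda>x. g x \<bullet> (projector (f x) *v h x))"
proof -
  have p: "continuous_on S (\<lambda>x. projector (f x))"
    by (rule continuous_on_compose2[OF continuous_on_projector assms(1)]) simp
  show ?thesis
    unfolding matrix_vector_mult_def by (intro continuous_intros p assms)
qed

text \<open>Path lifting for \<open>pair_of\<close>, whose source is not compact: the retracted path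
  is lifted through the compact covering \<open>frame_lines\<close>, and the remaining parameter is
  given by a formula.\<close>

lemma path_pair_lift:
  assumes c: "path c" "path_image c \<subseteq> distinct_pairs" and q0: "norm q0 = 1"
    "pair_lines (c 0) = frame_lines q0"
  obtains q s where "path q" "path_image q \<subseteq> sphere 0 1" "q 0 = q0" "path s" "path_image s \<subseteq> {-1<..<1}"
    "\<And>t. t \<in> {0..1} \<Longrightarrow> c t = pair_of (q t, s t)" "\<And>t. t \<in> {0..1} \<Longrightarrow> frame_lines (q t) = pair_lines (c t)"
proof -
  have "path (pair_lines \<circ> c)"
    using c continuous_on_pair_lines by (meson continuous_on_subset path_continuous_image)
  moreover have "path_image (pair_lines \<circ> c) \<subseteq> frame_lines ` sphere 0 1"
    using c(2) pair_lines_surj by (auto simp: path_image_compose)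
  moreover have "pathstart (pair_lines \<circ> c) = frame_lines q0" "q0 \<in> sphere 0 1"
    using q0 by (simp_all add: pathstart_def)
  ultimately obtain q where q: "path q" "path_image q \<subseteq> sphere 0 1" "pathstart q = q0"
    "\<And>t. t \<in> {0..1} \<Longrightarrow> frame_lines (q t) = (pair_lines \<circ> c) t"
    using covering_space_lift_path_strong[OF covering_space_frame_lines] by metis
  \<comment> \<open>By \<open>pair_of_cases\<close> the numerator is s * sqrt(1 - s^2) and the
    denominator sqrt(1 - s^2). No choice of unit vector on the second line enters, hence
    continuity.\<close>
  define s where "s t = (frame1 (q t) \<bullet> (projector (snd (c t)) *v frame2 (q t))) /
      sqrt (frame2 (q t) \<bullet> (projector (snd (c t)) *v frame2 (q t)))" for t
  have s: "\<bar>s t\<bar> < 1 \<and> c t = pair_of (q t, s t)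
    \<and> frame2 (q t) \<bullet> (projector (snd (c t)) *v frame2 (q t)) > 0"
    if t: "t \<in> {0..1}" for t
  proof -
    have "c t \<in> distinct_pairs" "norm (q t) = 1" "pair_lines (c t) = frame_lines (q t)"
      using c(2) t q(4) norm_path_in_sphere[OF q(2) t] by (auto simp: path_image_def)
    from pair_of_cases[OF this] obtain r where r: "\<bar>r\<bar> < 1" "c t = pair_of (q t, r)"
      "frame1 (q t) \<bullet> (projector (snd (c t)) *v frame2 (q t)) = r * sqrt (1 - r\<^sup>2)"
      "frame2 (q t) \<bullet> (projector (snd (c t)) *v frame2 (q t)) = 1 - r\<^sup>2" by blast
    moreover have "r\<^sup>2 < 1" using r(1) by (simp add: abs_square_less_1)
    moreover from this have "s t = r" unfolding s_def r(3,4) by simp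
    ultimately show ?thesis by simp
  qed
  have "continuous_on {0..1} q" "continuous_on {0..1} (\<lambda>t. snd (c t))"
    using q(1) c(1) by (auto simp: path_def intro: continuous_intros)
  then have "continuous_on {0..1} s"
    unfolding s_def
    by (intro continuous_on_divide continuous_on_real_sqrt continuous_on_projector_vec
      continuous_on_frame)
      (use s in force)+
  then have "path s" by (simp add: path_def)
  moreover have "path_image s \<subseteq> {-1<..<1}"
    using s by (auto simp: path_image_def abs_less_iff)
  moreover have "q 0 = q0" using q(3) by (simp add: pathstart_def)
  ultimately show ?thesis
    using that q(1,2,4) s by auto
qed

lemma path_lift_fst_pair:
  assumes q: "path q" "path_image q \<subseteq> sphere 0 1" and c: "\<And>t. t \<in> {0..1} \<Longrightarrow> c t = pair_of (q t, s t)"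
  shows "path_lift (fst \<circ> c) (frame1 (q 0)) (frame1 (q 1))"
proof -
  have "path_lift (fst \<circ> c) (pathstart (\<lambda>t. frame1 (q t))) (pathfinish (\<lambda>t. frame1 (q t)))"
  proof (rule path_liftI)
    show "path (\<lambda>t. frame1 (q t))"
      using q(1) by (auto simp: path_def intro: continuous_intros)
    show "path_image (\<lambda>t. frame1 (q t)) \<subseteq> sphere 0 1"
      using norm_path_in_sphere[OF q(2)] by (auto simp: path_image_def norm_frame)
  qed (auto simp: c pair_of_def)
  then show ?thesis by (simp add: pathstart_def pathfinish_def)
qed

lemma path_lift_snd_pair:
  assumes q: "path q" "path_image q \<subseteq> sphere 0 1" and s: "path s" "path_image s \<subseteq> {-1<..<1}"
    and c: "\<And>t. t \<in> {0..1} \<Longrightarrow> c t = pair_of (q t, s t)"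
  defines "v t \<equiv> s t *\<^sub>R frame1 (q t) + sqrt (1 - (s t)\<^sup>2) *\<^sub>R frame2 (q t)"
  shows "path_lift (snd \<circ> c) (v 0) (v 1)"
proof -
  have s': "\<bar>s t\<bar> < 1" if "t \<in> {0..1}" for t
  proof -
    have "s t \<in> {-1<..<1}" using s(2) that unfolding path_image_def by blast
    then show ?thesis by auto
  qed
  have "path_lift (snd \<circ> c) (pathstart v) (pathfinish v)"
  proof (rule path_liftI)
    show "path v"
      using q(1) s(1) unfolding v_def by (auto simp: path_def intro!: continuous_intros)
    show "path_image v \<subseteq> sphere 0 1"
      using norm_path_in_sphere[OF q(2)] s' by (auto simp: path_image_def v_def frame_comb)
  qed (auto simp: c pair_of_def v_def)
  then show ?thesis by (simp add: pathstart_def pathfinish_def)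
qed

section \<open>Squares of two-strand braids and their signs\<close>

lemma simply_connected_frames: "simply_connected (sphere 0 1 \<times> {-1<..<1} :: ((real^4) \<times> real) set)"
  by (intro simply_connected_Times simply_connected_sphere convex_imp_simply_connected) auto

text \<open>If both strands lift to closed loops, the lifted frame returns with both axes unchanged,
  so the quaternion returns up to sign. Going round twice closes the lift in a simply connected
  space.\<close>

lemma square_trivial_if_closed_lifts:
  assumes c: "path c" "path_image c \<subseteq> distinct_pairs" "c 0 = c 1"
    and 1: "closed_lift (fst \<circ> c)" and 2: "closed_lift (snd \<circ> c)"
  shows "homotopic_paths distinct_pairs (c +++ c) (\<lambda>_. c 0)"
proof -
  have "c 0 \<in> distinct_pairs" using c(2) by (auto simp: path_image_def)
  then obtain q0 where "norm q0 = 1" "pair_lines (c 0) = frame_lines q0"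
    using pair_lines_surj by fastforce
  from path_pair_lift[OF c(1,2) this]
  obtain q s where q: "path q" "path_image q \<subseteq> sphere 0 1" "q 0 = q0" and s: "path s"
    "path_image s \<subseteq> {-1<..<1}"
    and cqs: "\<And>t. t \<in> {0..1} \<Longrightarrow> c t = pair_of (q t, s t)" by blast
  have n: "norm (q 0) = 1" "norm (q 1) = 1" using norm_path_in_sphere[OF q(2)] by auto
  have "s 0 \<in> {-1<..<1}" "s 1 \<in> {-1<..<1}"
    using s(2) unfolding path_image_def image_subset_iff by simp_all
  then have sb: "\<bar>s 0\<bar> < 1" "\<bar>s 1\<bar> < 1" by auto
  have f1: "frame1 (q 1) = frame1 (q 0)"
    using closed_lift_iff[OF path_lift_fst_pair[OF q(1,2) cqs]] 1 by simp
  have f2: "s 1 *\<^sub>R frame1 (q 1) + sqrt (1 - (s 1)\<^sup>2) *\<^sub>R frame2 (q 1) = s 0 *\<^sub>R frame1 (q 0)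
    + sqrt (1 - (s 0)\<^sup>2) *\<^sub>R frame2 (q 0)"
    using closed_lift_iff[OF path_lift_snd_pair[OF q(1,2) s cqs]] 2 by simp
  \<comment> \<open>The inner product with the common first axis equals \<open>s\<close> at either
    end.\<close>
  have s01: "s 1 = s 0"
    using frame_comb(2)[OF n(1) sb(1)] frame_comb(2)[OF n(2) sb(2)] f1 f2 by metis
  then have f2': "frame2 (q 1) = frame2 (q 0)"
    using f1 f2 frame_comb(3)[OF n(1) sb(1)] by simp
  have "frame1 (q 0) \<noteq> 0" "frame2 (q 0) \<noteq> 0"
    using norm_frame[OF n(1)] by auto
  then have nz: "2 * frame1 (q 0) \<noteq> 0" "2 * frame2 (q 0) \<noteq> 0"
    by (auto simp: vec_eq_iff)
  have "q 1 = q 0 \<or> q 1 = - q 0"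
    using frame_fibre[OF n] f1 f2' inner_frame[OF n(1)] nz by auto
  then obtain e :: real where e: "q 1 = e *\<^sub>R q 0" "e = 1 \<or> e = -1"
    by (metis scaleR_one scaleR_minus1_left)
  \<comment> \<open>The second circuit has to start at \<open>q 1\<close>, so its lift is the first
    one multiplied by \<open>e\<close>; it ends at \<open>q 0\<close> because e * e = 1.\<close>
  define r where "r = (q +++ (\<lambda>t. e *\<^sub>R q t))"
  have qe: "path (\<lambda>t. e *\<^sub>R q t)" "path_image (\<lambda>t. e *\<^sub>R q t) \<subseteq> sphere 0 1"
    using q(1) e(2) norm_path_in_sphere[OF q(2)]
    by (auto simp: path_def path_image_def intro!: continuous_intros)
  have r: "path r" "path_image r \<subseteq> sphere 0 1" "pathstart r = q 0" "pathfinish r = q 0"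
    unfolding r_def using q(1,2) qe e
    by (simp_all add: subset_path_image_join path_join_eq) (auto simp: pathstart_def pathfinish_def)
  define w where "w = s +++ s"
  have w: "path w" "path_image w \<subseteq> {-1<..<1}" "pathstart w = s 0" "pathfinish w = s 0"
    unfolding w_def using s s01
    by (simp_all add: subset_path_image_join path_join_eq) (auto simp: pathstart_def pathfinish_def)
  have pe: "pair_of (e *\<^sub>R a, b) = pair_of (a, b)" for a b
    using e(2) by (auto simp: pair_of_def)
  have eq: "(c +++ c) t = pair_of (r t, w t)" if "t \<in> {0..1}" for t
    using that cqs by (auto simp: joinpaths_def r_def w_def pe)
  have rw: "homotopic_paths distinct_pairs (pair_of \<circ> (\<lambda>t. (r t, w t))) (pair_of \<circ> (\<lambda>_. (q 0, s 0)))"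
  proof (rule homotopic_paths_image_simply_connected[OF simply_connected_frames continuous_on_pair_of])
    show "pair_of \<in> sphere 0 1 \<times> {- 1<..<1} \<rightarrow> distinct_pairs"
      using pair_of_distinct by (auto simp: abs_less_iff)
    show "path (\<lambda>t. (r t, w t))"
      using r(1) w(1) by (auto simp: path_def intro: continuous_intros)
    show "path_image (\<lambda>t. (r t, w t)) \<subseteq> sphere 0 1 \<times> {- 1<..<1}"
      using r(2) w(2) unfolding path_image_def by blast
    show "path (\<lambda>_. (q 0, s 0))" by (simp add: path_def)
    show "path_image (\<lambda>_. (q 0, s 0)) \<subseteq> sphere 0 1 \<times> {- 1<..<1}"
      using n sb by (auto simp: path_image_def abs_less_iff)
  qed (use r w in \<open>auto simp: pathstart_def pathfinish_def\<close>)
  moreover have cc: "homotopic_paths distinct_pairs (c +++ c) (pair_of \<circ> (\<lambda>t. (r t, w t)))"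
    using c eq by (intro homotopic_paths_eq) (auto simp: path_image_join pathstart_def pathfinish_def)
  moreover have "pair_of \<circ> (\<lambda>_::real. (q 0, s 0)) = (\<lambda>_. c 0)"
    using cqs by auto
  ultimately show ?thesis
    using homotopic_paths_trans[OF cc rw] by (simp only:)
qed

text \<open>The homotopy is pushed along the retraction \<open>pair_lines\<close>, so that monodromy
  of the covering by frames applies.\<close>

lemma pair_monodromy:
  assumes h: "homotopic_paths distinct_pairs c d"
    and q: "path q" "path_image q \<subseteq> sphere 0 1" "\<And>t. t \<in> {0..1} \<Longrightarrow> frame_lines (q t) = pair_lines (c t)"
    and r: "path r" "path_image r \<subseteq> sphere 0 1" "\<And>t. t \<in> {0..1} \<Longrightarrow> frame_lines (r t) = pair_lines (d t)"
    and "q 0 = r 0"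
  shows "q 1 = r 1"
proof -
  let ?Y = "frame_lines ` sphere 0 1"
  have h': "homotopic_paths ?Y (pair_lines \<circ> c) (pair_lines \<circ> d)"
    using h by (rule homotopic_paths_continuous_image[OF _ continuous_on_pair_lines]) (use
      pair_lines_surj in auto)
  have "pathfinish q = pathfinish r"
    by (rule covering_space_monodromy[OF covering_space_frame_lines _ _ _ _ h' q(1,2) _ r(1,2)])
      (use homotopic_paths_imp_path[OF h'] homotopic_paths_imp_subset[OF h'] assms in \<open>auto
        simp: pathstart_def\<close>)
  then show ?thesis by (simp add: pathfinish_def)
qed

text \<open>The lift ends at \<open>g q0\<close> for a deck transformation \<open>g\<close>, and the
  lift of the square ends at \<open>g (g q0)\<close>. If the square is trivial, \<open>g\<close>
  squares to the identity, so it is the identity or the negation, and both keep the first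
  axis.\<close>

lemma closed_lift_fst_if_square_trivial:
  assumes c: "path c" "path_image c \<subseteq> distinct_pairs" "c 0 = c 1"
    and h: "homotopic_paths distinct_pairs (c +++ c) (\<lambda>_. c 0)"
  shows "closed_lift (fst \<circ> c)"
proof -
  have "c 0 \<in> distinct_pairs" using c(2) by (auto simp: path_image_def)
  then obtain q0 where q0: "norm q0 = 1" "pair_lines (c 0) = frame_lines q0"
    using pair_lines_surj by fastforce
  from path_pair_lift[OF c(1,2) this]
  obtain q s where q: "path q" "path_image q \<subseteq> sphere 0 1" "q 0 = q0"
    and cqs: "\<And>t. t \<in> {0..1} \<Longrightarrow> c t = pair_of (q t, s t)"
    and fl: "\<And>t. t \<in> {0..1} \<Longrightarrow> frame_lines (q t) = pair_lines (c t)" by blast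
  have n: "norm (q t) = 1" if "t \<in> {0..1}" for t using norm_path_in_sphere[OF q(2)] that by auto
  have "frame_lines (q 0) = frame_lines (q 1)" using fl c(3) by simp
  then obtain g where g: "g \<in> frame_deck" "q 1 = g (q 0)"
    using frame_lines_eq_iff[OF n n] by auto
  have gq: "path (g \<circ> q)" "path_image (g \<circ> q) \<subseteq> sphere 0 1"
    using path_continuous_image[OF q(1) frame_deck_continuous[OF g(1)]] frame_deck_norm[OF g(1)] q(2)
    by (auto simp: path_image_def)
  have "(q +++ (g \<circ> q)) 1 = (\<lambda>_::real. q0) 1"
  proof (rule pair_monodromy[OF h])
    show "path (q +++ (g \<circ> q))" "path_image (q +++ (g \<circ> q)) \<subseteq> sphere 0 1"
      using q gq g by (auto simp: path_image_join pathstart_def pathfinish_def)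
    show "frame_lines ((q +++ (g \<circ> q)) t) = pair_lines ((c +++ c) t)" if "t \<in> {0..1}" for t
      using that fl by (auto simp: joinpaths_def frame_deck_lines[OF g(1)])
    show "path (\<lambda>_. q0)" "path_image (\<lambda>_. q0) \<subseteq> sphere 0 1" "frame_lines q0 = pair_lines (c 0)"
      using q0 by (auto simp: path_def path_image_def)
    show "(q +++ (g \<circ> q)) 0 = q0" using q(3) by (simp add: joinpaths_def)
  qed
  then have "g (g q0) = q0" using g q(3) by (simp add: joinpaths_def)
  moreover have "q0 \<noteq> 0" using q0 by auto
  then have "2 * q0 \<noteq> 0" by (auto simp: vec_eq_iff)
  ultimately have "frame1 (g q0) = frame1 q0"
    using g(1) unfolding frame_deck_def by (elim insertE emptyE) auto
  then show ?thesis
    using closed_lift_iff[OF path_lift_fst_pair[OF q(1,2) cqs]] g q(3) by simp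
qed

lemma closed_lift_fst_homotopic:
  assumes h: "homotopic_paths distinct_pairs c d" and c: "closed_lift (fst \<circ> c)"
  shows "closed_lift (fst \<circ> d)"
proof -
  have p: "path c" "path_image c \<subseteq> distinct_pairs" "path d" "path_image d \<subseteq> distinct_pairs"
    using homotopic_paths_imp_path[OF h] homotopic_paths_imp_subset[OF h] by auto
  have cd: "c 0 = d 0" using homotopic_paths_imp_pathstart[OF h] by (simp add: pathstart_def)
  have "c 0 \<in> distinct_pairs" using p(2) by (auto simp: path_image_def)
  then obtain q0 where q0: "norm q0 = 1" "pair_lines (c 0) = frame_lines q0"
    using pair_lines_surj by fastforce
  from path_pair_lift[OF p(1,2) q0]
  obtain q s where q: "path q" "path_image q \<subseteq> sphere 0 1" "q 0 = q0"
    and cqs: "\<And>t. t \<in> {0..1} \<Longrightarrow> c t = pair_of (q t, s t)"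
    and qfl: "\<And>t. t \<in> {0..1} \<Longrightarrow> frame_lines (q t) = pair_lines (c t)" by blast
  from path_pair_lift[OF p(3,4) q0(1)] q0(2) cd
  obtain r s' where r: "path r" "path_image r \<subseteq> sphere 0 1" "r 0 = q0"
    and drs: "\<And>t. t \<in> {0..1} \<Longrightarrow> d t = pair_of (r t, s' t)"
    and rfl: "\<And>t. t \<in> {0..1} \<Longrightarrow> frame_lines (r t) = pair_lines (d t)" by metis
  have "q 1 = r 1"
    using pair_monodromy[OF h q(1,2) qfl r(1,2) rfl] q(3) r(3) by simp
  then show ?thesis
    using closed_lift_iff[OF path_lift_fst_pair[OF q(1,2) cqs]] closed_lift_iff[OF
      path_lift_fst_pair[OF r(1,2) drs]]
      c q(3) r(3) by simp
qed

text \<open>\<open>pair_lines\<close> keeps the first line and alters the second. Results on the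
  second strand are therefore obtained from those on the first by interchanging the lines.\<close>

lemma homotopic_paths_swap:
  assumes "homotopic_paths distinct_pairs c d"
  shows "homotopic_paths distinct_pairs (prod.swap \<circ> c) (prod.swap \<circ> d)"
  using assms
  by (rule homotopic_paths_continuous_image) (auto simp: distinct_pairs_def continuous_on_swap)

lemma closed_lift_snd_homotopic:
  assumes "homotopic_paths distinct_pairs c d" "closed_lift (snd \<circ> c)"
  shows "closed_lift (snd \<circ> d)"
  using closed_lift_fst_homotopic[OF homotopic_paths_swap[OF assms(1)]] assms(2)
  by (simp add: o_def)

lemma closed_lift_snd_if_square_trivial:
  assumes c: "path c" "path_image c \<subseteq> distinct_pairs" "c 0 = c 1"
    and h: "homotopic_paths distinct_pairs (c +++ c) (\<lambda>_. c 0)"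
  shows "closed_lift (snd \<circ> c)"
proof -
  have "homotopic_paths distinct_pairs ((prod.swap \<circ> c) +++ (prod.swap \<circ> c)) (\<lambda>_. (prod.swap \<circ> c) 0)"
    using homotopic_paths_swap[OF h] unfolding path_compose_join by (simp only: o_def)
  moreover have "path (prod.swap \<circ> c)" "path_image (prod.swap \<circ> c) \<subseteq> distinct_pairs"
    using c by (auto simp: path_image_def distinct_pairs_def intro!: path_continuous_image
      continuous_on_swap)
  ultimately have "closed_lift (fst \<circ> (prod.swap \<circ> c))"
    using c(3) by (intro closed_lift_fst_if_square_trivial) auto
  then show ?thesis by (simp add: o_def)
qed

lemma square_homotopic_closed_lifts:
  assumes c: "path c" "path_image c \<subseteq> distinct_pairs" "c 0 = c 1"
    and d: "path d" "path_image d \<subseteq> distinct_pairs" "d 0 = d 1"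
    and h: "homotopic_paths distinct_pairs (c +++ c) (d +++ d)"
    and 1: "closed_lift (fst \<circ> c)" and 2: "closed_lift (snd \<circ> c)"
  shows "closed_lift (fst \<circ> d)" "closed_lift (snd \<circ> d)"
proof -
  have "c 0 = d 0"
    using homotopic_paths_imp_pathstart[OF h] by (simp add: pathstart_def joinpaths_def)
  then have "homotopic_paths distinct_pairs (d +++ d) (\<lambda>_. d 0)"
    using square_trivial_if_closed_lifts[OF c 1 2] h by (metis homotopic_paths_sym homotopic_paths_trans)
  then show "closed_lift (fst \<circ> d)" "closed_lift (snd \<circ> d)"
    using closed_lift_fst_if_square_trivial[OF d] closed_lift_snd_if_square_trivial[OF d] by auto
qed

section \<open>Loops in configuration spaces\<close>

definition path_class :: "'a::topological_space set \<Rightarrow> (real \<Rightarrow> 'a) \<Rightarrow> (real \<Rightarrow> 'a) set" where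
  "path_class S p = {r. homotopic_paths S p r}"

lemma carrier_fundamental_group:
  "carrier (fundamental_group S x) = path_class S ` loops_at S x"
  by (auto simp: fundamental_group_def quotient_def path_class_def)

lemma path_class_eq_iff:
  assumes "path p" "path_image p \<subseteq> S"
  shows "path_class S p = path_class S q \<longleftrightarrow> homotopic_paths S p q"
proof
  assume "path_class S p = path_class S q"
  then have "homotopic_paths S q p" using assms by (auto simp: path_class_def)
  then show "homotopic_paths S p q" by (rule homotopic_paths_sym)
next
  assume "homotopic_paths S p q"
  then show "path_class S p = path_class S q"
    unfolding path_class_def
    using homotopic_paths_trans[of S p q] homotopic_paths_trans[of S q p] homotopic_paths_sym[of S p
      q] by blast
qed

lemma mult_path_class:
  assumes p: "p \<in> loops_at S x" and q: "q \<in> loops_at S x"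
  shows "path_class S p \<otimes>\<^bsub>fundamental_group S x\<^esub> path_class S q = path_class S (p +++ q)"
proof -
  have pq: "path p" "path_image p \<subseteq> S" "path q" "path_image q \<subseteq> S" "pathfinish p = pathstart q"
    using p q by (auto simp: loops_at_def)
  have "homotopic_paths S (p +++ q) r" if "homotopic_paths S p p'" "homotopic_paths S q q'"
    "homotopic_paths S (p' +++ q') r" for p' q' r
    using homotopic_paths_trans[OF homotopic_paths_join[OF that(1,2) pq(5)] that(3)] .
  moreover have "homotopic_paths S p p" "homotopic_paths S q q" using pq by auto
  moreover have "path_class S p \<otimes>\<^bsub>fundamental_group S x\<^esub> path_class S q =
      {r. \<exists>p'\<in>path_class S p. \<exists>q'\<in>path_class S q. homotopic_paths S (p' +++ q') r}"
    by (simp add: fundamental_group_def)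
  ultimately show ?thesis
    unfolding path_class_def by blast
qed

lemma join_loops_at: "p \<in> loops_at S x \<Longrightarrow> q \<in> loops_at S x \<Longrightarrow> p +++ q \<in> loops_at S x"
  by (auto simp: loops_at_def path_image_join)

section \<open>Signs of the strands of a pure braid\<close>

definition strands :: "nat \<Rightarrow> nat \<Rightarrow> (nat \<Rightarrow> rp2) \<Rightarrow> rp2 \<times> rp2" where
  "strands i j f = (f i, f j)"

lemma continuous_on_strands: "continuous_on S (strands i j)"
  unfolding strands_def
  by (intro continuous_on_Pair continuous_on_subset[OF continuous_on_product_coordinates]) auto

lemma strands_config:
  "i \<noteq> j \<Longrightarrow> i \<in> {1..n} \<Longrightarrow> j \<in> {1..n} \<Longrightarrow> strands i j \<in> config_space n UNIV \<rightarrow> distinct_pairs"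
  using inj_onD[of _ "{1..n}" i j] by (simp add: strands_def config_space_def distinct_pairs_def
    Pi_def) blast

lemma loop_strands:
  assumes a: "a \<in> loops_at (config_space n UNIV) x" and ij: "i \<noteq> j" "i \<in> {1..n}" "j \<in> {1..n}"
  shows "path (strands i j \<circ> a)" "path_image (strands i j \<circ> a) \<subseteq> distinct_pairs"
    "(strands i j \<circ> a) 0 = (strands i j \<circ> a) 1"
proof -
  have a': "path a" "path_image a \<subseteq> config_space n UNIV" "a 0 = a 1"
    using a by (auto simp: loops_at_def pathstart_def pathfinish_def)
  show "path (strands i j \<circ> a)"
    by (intro path_continuous_image a' continuous_on_strands)
  show "path_image (strands i j \<circ> a) \<subseteq> distinct_pairs"
    using funcset_image[OF strands_config[OF ij]] a'(2) unfolding path_image_compose by blast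
  show "(strands i j \<circ> a) 0 = (strands i j \<circ> a) 1" using a'(3) by simp
qed

text \<open>A strand is lifted together with a companion that never meets it: the first axis of the
  lifted frame is the lift.\<close>

lemma path_lift_exists:
  assumes "path c" "path_image c \<subseteq> distinct_pairs"
  shows "\<exists>u v. path_lift (fst \<circ> c) u v"
proof -
  have "c 0 \<in> distinct_pairs" using assms(2) by (auto simp: path_image_def)
  then obtain q0 where "norm q0 = 1" "pair_lines (c 0) = frame_lines q0"
    using pair_lines_surj by fastforce
  from path_pair_lift[OF assms this] show ?thesis
    using path_lift_fst_pair by metis
qed

definition closed_strand :: "(real \<Rightarrow> nat \<Rightarrow> rp2) \<Rightarrow> nat \<Rightarrow> bool" where
  "closed_strand a i \<longleftrightarrow> closed_lift (\<lambda>t. a t i)"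

lemma closed_strand_fst: "closed_lift (fst \<circ> (strands i j \<circ> a)) \<longleftrightarrow> closed_strand a i"
  and closed_strand_snd: "closed_lift (snd \<circ> (strands i j \<circ> a)) \<longleftrightarrow> closed_strand a j"
  by (simp_all add: closed_strand_def strands_def o_def)

lemma closed_strand_join:
  assumes a: "a \<in> loops_at (config_space n UNIV) x" and b: "b \<in> loops_at (config_space n UNIV) x"
    and n: "n \<ge> 2" "i \<in> {1..n}"
  shows "closed_strand (a +++ b) i \<longleftrightarrow> (closed_strand a i \<longleftrightarrow> closed_strand b i)"
proof -
  \<comment> \<open>Any other strand will do as the companion.\<close>
  define j where "j = (if i = 1 then 2 else 1 :: nat)"
  have ij: "i \<noteq> j" "i \<in> {1..n}" "j \<in> {1..n}" using n by (auto simp: j_def)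
  obtain u v where a': "path_lift (fst \<circ> (strands i j \<circ> a)) u v"
    using path_lift_exists[OF loop_strands(1,2)[OF a ij]] by blast
  obtain w z where b': "path_lift (fst \<circ> (strands i j \<circ> b)) w z"
    using path_lift_exists[OF loop_strands(1,2)[OF b ij]] by blast
  have "(fst \<circ> (strands i j \<circ> (a +++ b))) = (fst \<circ> (strands i j \<circ> a)) +++ (fst \<circ> (strands i j \<circ> b))"
    by (simp only: path_compose_join)
  then have "closed_strand (a +++ b) i \<longleftrightarrow> closed_lift ((fst \<circ> (strands i j \<circ> a))
    +++ (fst \<circ> (strands i j \<circ> b)))"
    using closed_strand_fst[of i j "a +++ b"] by simp
  moreover have "a 0 = a 1" "a 1 = b 0" "b 0 = b 1"
    using a b by (auto simp: loops_at_def pathstart_def pathfinish_def)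
  ultimately show ?thesis
    using closed_lift_join[OF a' b'] closed_strand_fst[of i j] by simp
qed

lemma square_homotopic_closed_strands:
  assumes a: "a \<in> loops_at (config_space n UNIV) x" and b: "b \<in> loops_at (config_space n UNIV) x"
    and h: "homotopic_paths (config_space n UNIV) (a +++ a) (b +++ b)"
    and ij: "i \<noteq> j" "i \<in> {1..n}" "j \<in> {1..n}" and "closed_strand a i" "closed_strand a j"
  shows "closed_strand b i \<and> closed_strand b j"
proof -
  have "homotopic_paths distinct_pairs ((strands i j \<circ> a) +++ (strands i j \<circ> a)) ((strands i j \<circ> b)
    +++ (strands i j \<circ> b))"
    unfolding path_compose_join[symmetric]
    by (rule homotopic_paths_continuous_image[OF h continuous_on_strands strands_config[OF ij]])
  from square_homotopic_closed_lifts[OF loop_strands[OF a ij] loop_strands[OF b ij] this]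
  show ?thesis using assms by (simp add: closed_strand_fst closed_strand_snd)
qed

lemma no_quaternion_loops:
  assumes n: "n \<ge> 4"
    and a: "a \<in> loops_at (config_space n UNIV) x" and b: "b \<in> loops_at (config_space n UNIV) x"
    and ab: "homotopic_paths (config_space n UNIV) (a +++ a) (b +++ b)"
    and ac: "homotopic_paths (config_space n UNIV) (a +++ a) ((a +++ b) +++ (a +++ b))"
    and sa: "closed_strand a 1" "\<not> closed_strand a 2"
    and sb: "\<not> closed_strand b 1" "closed_strand b 2"
  shows False
proof -
  note c = join_loops_at[OF a b]
  \<comment> \<open>Were \<open>a\<close> closed on strand \<open>i\<close>, it would be closed on 1
    and \<open>i\<close>, and the relation between the squares would close \<open>b\<close> on
    strand 1; likewise for \<open>b\<close> and strand 2. Two reversing signs then multiply to a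
    preserving one.\<close>
  have 3: "closed_strand (a +++ b) i" "\<not> closed_strand a i" if "i \<in> {3..4}" for i
  proof -
    have i: "i \<in> {1..n}" "1 \<noteq> i" "2 \<noteq> i" "1 \<in> {1..n}" "2 \<in> {1..n}" "n \<ge> 2" using that n by auto
    show "\<not> closed_strand a i"
      using square_homotopic_closed_strands[OF a b ab i(2) i(4) i(1)] sa sb by blast
    moreover have "\<not> closed_strand b i"
      using square_homotopic_closed_strands[OF b a homotopic_paths_sym[OF ab] i(3) i(5) i(1)] sa sb
        by blast
    ultimately show "closed_strand (a +++ b) i"
      using closed_strand_join[OF a b i(6) i(1)] by blast
  qed
  have "closed_strand a 3"
    using square_homotopic_closed_strands[OF c a homotopic_paths_sym[OF ac], of 3 4] 3[of 3] 3[of 4]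
      n by simp
  then show False using 3[of 3] by simp
qed

section \<open>Loops of frame configurations\<close>

definition frame_config :: "nat \<Rightarrow> real^4 \<Rightarrow> nat \<Rightarrow> rp2" where
  "frame_config n q = restrict (\<lambda>i. abs_rp2 (if i = 1 then frame1 q else if i
    = 2 then frame2 q else frame3 q)) {1..n}"

text \<open>The bound on \<open>n\<close> is essential: a fourth point would repeat the third
  axis.\<close>

lemma frame_config_in:
  assumes "n \<le> 3" "norm q = 1"
  shows "frame_config n q \<in> config_space n UNIV"
proof -
  have ne: "abs_rp2 u \<noteq> abs_rp2 v" if "norm u = 1" "norm v = 1" "u \<bullet> v = 0" for u v :: "real^3"
    using abs_rp2_eq_iff[OF that(1,2)] that by (auto simp: dot_square_norm)
  have ne': "abs_rp2 (frame1 q) \<noteq> abs_rp2 (frame2 q)" "abs_rp2 (frame1 q) \<noteq> abs_rp2 (frame3 q)"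
    "abs_rp2 (frame2 q) \<noteq> abs_rp2 (frame3 q)"
    using norm_frame[OF assms(2)] inner_frame[OF assms(2)] by (simp_all add: ne)
  have "i = 1 \<or> i = 2 \<or> i = 3" if "i \<in> {1..n}" for i using that assms(1) by auto
  then have "inj_on (\<lambda>i::nat. abs_rp2 (if i = 1 then frame1 q else if i
    = 2 then frame2 q else frame3 q)) {1..n}"
    using ne' by (intro inj_onI) (smt (verit) ne')
  then show ?thesis
    unfolding config_space_def frame_config_def by (auto simp: inj_on_restrict_eq)
qed

lemma continuous_on_frame_config: "continuous_on (sphere 0 1) (frame_config n)"
proof (rule continuous_on_coordinatewise_then_product)
  fix i
  consider "i \<notin> {1..n}" | "i \<in> {1..n}" "i = 1" | "i \<in> {1..n}" "i = 2" | "i \<in> {1..n}" "i \<noteq> 1" "i \<noteq> 2"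
    by blast
  then show "continuous_on (sphere 0 1) (\<lambda>q. frame_config n q i)"
  proof cases
    case 1 then show ?thesis by (simp add: frame_config_def restrict_def del: atLeastAtMost_iff)
  qed (simp_all add: frame_config_def restrict_def del: atLeastAtMost_iff,
      (rule continuous_on_compose2[OF continuous_on_abs_rp2], intro continuous_intros, auto
        simp: norm_frame)+)
qed

lemma frame_config_deck:
  assumes "g \<in> frame_deck" "norm q = 1"
  shows "frame_config n (g q) = frame_config n q"
  using assms(1) abs_rp2_minus[OF norm_frame(1)[OF assms(2)]] abs_rp2_minus[OF norm_frame(2)[OF
    assms(2)]]
    abs_rp2_minus[OF norm_frame(3)[OF assms(2)]]
  unfolding frame_config_def frame_deck_def by (elim insertE emptyE; simp add: restrict_def fun_eq_iff)

text \<open>Only the end points are kept, because by \<open>frame_lift_homotopic\<close> they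
  determine the homotopy class when \<open>n \<le> 3\<close>.\<close>

definition frame_lift :: "nat \<Rightarrow> (real \<Rightarrow> nat \<Rightarrow> rp2) \<Rightarrow> real^4 \<Rightarrow> real^4 \<Rightarrow> bool" where
  "frame_lift n p a b \<longleftrightarrow> (\<exists>q. path q \<and> path_image q \<subseteq> sphere 0 1 \<and> pathstart q = a \<and> pathfinish q = b \<and>
     (\<forall>t\<in>{0..1}. p t = frame_config n (q t)))"

lemma frame_lift_join:
  assumes "frame_lift n p a b" "frame_lift n r b c"
  shows "frame_lift n (p +++ r) a c"
proof -
  obtain q where q: "path q" "path_image q \<subseteq> sphere 0 1" "pathstart q = a" "pathfinish q = b"
     "\<forall>t\<in>{0..1}. p t = frame_config n (q t)"
    using assms(1) unfolding frame_lift_def by blast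
  obtain s where s: "path s" "path_image s \<subseteq> sphere 0 1" "pathstart s = b" "pathfinish s = c"
     "\<forall>t\<in>{0..1}. r t = frame_config n (s t)"
    using assms(2) unfolding frame_lift_def by blast
  have "(p +++ r) t = frame_config n ((q +++ s) t)" if "t \<in> {0..1}" for t
    using that q(5) s(5) by (auto simp: joinpaths_def)
  then show ?thesis
    unfolding frame_lift_def using q s by (intro exI[of _ "q +++ s"]) (simp add: subset_path_image_join)
qed

text \<open>Allows a loop to be followed from any quaternion above its base frame, as needed for the
  second factor of a concatenation.\<close>

lemma frame_lift_deck:
  assumes "frame_lift n p a b" and g: "g \<in> frame_deck"
  shows "frame_lift n p (g a) (g b)"
proof -
  obtain q where q: "path q" "path_image q \<subseteq> sphere 0 1" "pathstart q = a" "pathfinish q = b"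
     "\<forall>t\<in>{0..1}. p t = frame_config n (q t)"
    using assms(1) unfolding frame_lift_def by blast
  have "path (g \<circ> q)" by (intro path_continuous_image q frame_deck_continuous g)
  moreover have "path_image (g \<circ> q) \<subseteq> sphere 0 1"
    using q(2) by (auto simp: path_image_def frame_deck_norm[OF g])
  moreover have "p t = frame_config n ((g \<circ> q) t)" if "t \<in> {0..1}" for t
    using q(5) that frame_config_deck[OF g norm_path_in_sphere[OF q(2) that]] by simp
  ultimately show ?thesis
    unfolding frame_lift_def using q(3,4) by (intro exI[of _ "g \<circ> q"]) (simp add: pathstart_compose
      pathfinish_compose)
qed

lemma frame_lift_homotopic:
  assumes n: "n \<le> 3" and p: "frame_lift n p a b" and r: "frame_lift n r a b"
  shows "homotopic_paths (config_space n UNIV) p r"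
proof -
  obtain q where q: "path q" "path_image q \<subseteq> sphere 0 1" "pathstart q = a" "pathfinish q = b"
     "\<forall>t\<in>{0..1}. p t = frame_config n (q t)"
    using p unfolding frame_lift_def by blast
  obtain s where s: "path s" "path_image s \<subseteq> sphere 0 1" "pathstart s = a" "pathfinish s = b"
     "\<forall>t\<in>{0..1}. r t = frame_config n (s t)"
    using r unfolding frame_lift_def by blast
  let ?F = "frame_config n"
  have F: "?F \<in> sphere 0 1 \<rightarrow> config_space n UNIV" using frame_config_in[OF n] by auto
  have h: "homotopic_paths (config_space n UNIV) (?F \<circ> q) (?F \<circ> s)"
    using q s F by (intro homotopic_paths_image_simply_connected[OF simply_connected_sphere
      continuous_on_frame_config]) auto
  have "homotopic_paths (config_space n UNIV) (?F \<circ> q) p"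
    using homotopic_paths_imp_path[OF h] homotopic_paths_imp_subset[OF h] q(5) by (intro
      homotopic_paths_eq) auto
  moreover have "homotopic_paths (config_space n UNIV) (?F \<circ> s) r"
    using homotopic_paths_imp_path[OF h] homotopic_paths_imp_subset[OF h] s(5) by (intro
      homotopic_paths_eq) auto
  ultimately show ?thesis
    using h by (meson homotopic_paths_sym homotopic_paths_trans)
qed

lemma path_lift_strand:
  assumes "frame_lift n p a b" "n \<ge> 2"
  shows "path_lift (\<lambda>t. p t 1) (frame1 a) (frame1 b)" "path_lift (\<lambda>t. p t 2) (frame2 a) (frame2 b)"
proof -
  obtain q where q: "path q" "path_image q \<subseteq> sphere 0 1" "pathstart q = a" "pathfinish q = b"
     "\<forall>t\<in>{0..1}. p t = frame_config n (q t)"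
    using assms unfolding frame_lift_def by blast
  have "path_lift (\<lambda>t. p t 1) (pathstart (frame1 \<circ> q)) (pathfinish (frame1 \<circ> q))"
    using q norm_path_in_sphere[OF q(2)] assms(2)
    by (intro path_liftI path_continuous_image continuous_on_frame continuous_on_id)
       (auto simp: path_image_def norm_frame frame_config_def)
  then show "path_lift (\<lambda>t. p t 1) (frame1 a) (frame1 b)"
    using q by (simp add: pathstart_compose pathfinish_compose)
  have "path_lift (\<lambda>t. p t 2) (pathstart (frame2 \<circ> q)) (pathfinish (frame2 \<circ> q))"
    using q norm_path_in_sphere[OF q(2)] assms(2)
    by (intro path_liftI path_continuous_image continuous_on_frame continuous_on_id)
       (auto simp: path_image_def norm_frame frame_config_def)
  then show "path_lift (\<lambda>t. p t 2) (frame2 a) (frame2 b)"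
    using q by (simp add: pathstart_compose pathfinish_compose)
qed

section \<open>Deforming a configuration to a frame\<close>

lemma abs_rp2_normalize_eq:
  assumes "a \<noteq> 0" "b \<noteq> 0" "abs_rp2 (a /\<^sub>R norm a) = abs_rp2 (b /\<^sub>R norm b)"
  obtains c where "c \<noteq> 0" "b = c *\<^sub>R a"
proof -
  have "norm (a /\<^sub>R norm a) = 1" "norm (b /\<^sub>R norm b) = 1" using assms by simp_all
  then have "b /\<^sub>R norm b = a /\<^sub>R norm a \<or> b /\<^sub>R norm b = - (a /\<^sub>R norm a)"
    using abs_rp2_eq_iff assms(3) by blast
  moreover have "b = norm b *\<^sub>R (b /\<^sub>R norm b)" using assms by simp
  ultimately have "b = norm b *\<^sub>R (a /\<^sub>R norm a) \<or> b = norm b *\<^sub>R (- (a /\<^sub>R norm a))"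
    by metis
  then have "b = (norm b / norm a) *\<^sub>R a \<or> b = (- norm b / norm a) *\<^sub>R a"
    by (simp add: divide_inverse)
  moreover have "norm b / norm a \<noteq> 0" "- norm b / norm a \<noteq> 0" using assms by simp_all
  ultimately show ?thesis using that by blast
qed

text \<open>Representing vectors move along segments to a Gram-Schmidt frame of the first two, and
  components along \<open>frame2 q\<close> and \<open>e3\<close> keep the lines distinct. The sphere
  lifts of the first two strands are recorded for computing the signs of conjugated loops.\<close>

lemma path_to_frame_config:
  assumes n: "n = 2 \<or> n = 3" and x: "inj_on x {1..n}"
  obtains q \<gamma> u v where "norm q = 1" "path \<gamma>" "path_image \<gamma> \<subseteq> config_space n UNIV"
    "pathstart \<gamma> = restrict x {1..n}" "pathfinish \<gamma> = frame_config n q"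
    "path_lift (\<lambda>t. \<gamma> t 1) u (frame1 q)" "path_lift (\<lambda>t. \<gamma> t 2) v (frame2 q)"
proof -
  have "\<exists>v. norm v = 1 \<and> x i = abs_rp2 v" for i
    using rp2_cases[where x = "x i"] by blast
  then obtain v where v: "\<And>i. norm (v i) = 1" "\<And>i. x i = abs_rp2 (v i)"
    by metis
  have x12: "x 1 \<noteq> x 2" using inj_onD[OF x, of 1 2] n by auto
  then have nz: "perp (v 1) (v 2) \<noteq> 0" using perp_nonzero v by metis
  have "v 1 \<bullet> perp (v 1) (v 2) = 0" using v(1) by (simp add: perp_def inner_diff_right dot_square_norm)
  then obtain q where q: "norm q = 1" "frame1 q = v 1" "frame2 q
    = perp (v 1) (v 2) /\<^sub>R norm (perp (v 1) (v 2))"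
    using frame_surj[of "v 1" "perp (v 1) (v 2) /\<^sub>R norm (perp (v 1) (v 2))"] v(1) nz by auto
  define k where "k = norm (perp (v 1) (v 2))"
  have k: "k > 0" using nz by (simp add: k_def)
  have "k *\<^sub>R frame2 q = v 2 - (v 1 \<bullet> v 2) *\<^sub>R v 1"
    using q(3) k by (simp add: k_def perp_def)
  then have v2: "v 2 = (v 1 \<bullet> v 2) *\<^sub>R frame1 q + k *\<^sub>R frame2 q"
    using q(2) by simp
  note I = inner_frame[OF q(1)] inner_commute[of "frame2 q" "frame1 q"] inner_commute[of "frame3 q"
    "frame1 q"]
    inner_commute[of "frame3 q" "frame2 q"]
  \<comment> \<open>The sign is chosen so that the third vector never has a negative component along
    \<open>e3\<close>; on its segment to \<open>e3\<close> this component is then positive for every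
    t > 0.\<close>
  define e3 where "e3 = (if frame3 q \<bullet> v 3 \<ge> 0 then frame3 q else - frame3 q)"
  have e3: "norm e3 = 1" "e3 \<bullet> e3 = 1" "e3 \<bullet> frame1 q = 0" "e3 \<bullet> frame2 q = 0" "e3 \<bullet> v 3 \<ge> 0"
    "abs_rp2 e3 = abs_rp2 (frame3 q)"
    using norm_frame[OF q(1)] abs_rp2_minus[of "frame3 q"] I by (auto simp: e3_def)
  have e3v2: "e3 \<bullet> v 1 = 0" "e3 \<bullet> v 2 = 0"
    using e3(3,4) q(2) by (simp, subst v2, simp add: inner_add_right)
  have f2v: "frame2 q \<bullet> v 1 = 0" "frame2 q \<bullet> v 2 = k"
    using I q(2) by (simp, subst v2, simp add: inner_add_right)
  define e where "e i = (if i = 1 then frame1 q else if i = 2 then frame2 q else e3)" for i :: nat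
  \<comment> \<open>Vector 1 stays fixed, vector 2 moves in the plane of the first two, and all
    indices from 3 on share the motion of vector 3.\<close>
  define w where "w i t = (1 - t) *\<^sub>R (if i < 3 then v i else v 3) + t *\<^sub>R e i" for i :: nat and t
    :: real
  have pos2: "frame2 q \<bullet> w 2 t > 0" if "t \<in> {0..1}" for t
  proof -
    have "frame2 q \<bullet> w 2 t = (1 - t) * k + t"
      using f2v I by (simp add: w_def e_def inner_add_right)
    also have "\<dots> > 0" using that k by (cases "t = 1") (auto intro: add_pos_nonneg)
    finally show ?thesis .
  qed
  have z2: "frame2 q \<bullet> w 1 t = 0" "e3 \<bullet> w 1 t = 0" "e3 \<bullet> w 2 t = 0" for t
    using f2v e3v2 e3 I by (simp_all add: w_def e_def inner_add_right)
  have pos3: "e3 \<bullet> w i t > 0" if "t \<in> {0..1}" "t > 0" "i \<ge> 3" for i t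
  proof -
    have "e3 \<bullet> w i t = (1 - t) * (e3 \<bullet> v 3) + t"
      using e3 that by (simp add: w_def e_def inner_add_right)
    also have "\<dots> > 0" using that e3(5) by (intro add_nonneg_pos) auto
    finally show ?thesis .
  qed
  have w0: "w i 0 = (if i < 3 then v i else v 3)" for i by (simp add: w_def)
  have w1: "w 1 t = v 1" for t using q(2) by (simp add: w_def e_def algebra_simps flip: scaleR_add_left)
  have wn: "w i t \<noteq> 0" if "t \<in> {0..1}" "i \<ge> 1" for i t
  proof -
    have "i = 1 \<or> i = 2 \<or> i \<ge> 3" "t = 0 \<or> t > 0" using that by auto
    then consider "i = 1" | "i = 2" | "i \<ge> 3" "t = 0" | "i \<ge> 3" "t > 0" by blast
    then show ?thesis
    proof cases
      case 1 then show ?thesis using w1 v(1)[of 1] by auto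
    next
      case 2 then show ?thesis using pos2[OF that(1)] by auto
    next
      case 3 then show ?thesis using w0 v(1)[of 3] by auto
    next
      case 4 then show ?thesis using pos3[OF that(1) 4(2,1)] by auto
    qed
  qed
  define l where "l i t = abs_rp2 (w i t /\<^sub>R norm (w i t))" for i t
  have l12: "l 1 t \<noteq> l 2 t" if t: "t \<in> {0..1}" for t
  proof
    assume "l 1 t = l 2 t"
    then obtain c where c: "w 2 t = c *\<^sub>R w 1 t"
      using abs_rp2_normalize_eq[OF wn[OF t order_refl] wn[OF t one_le_numeral]] unfolding l_def by metis
    then show False using pos2[OF t] z2(1)[of t] by simp
  qed
  have l03: "l i 0 = x i" if "i \<in> {1..3}" for i
    using that v by (auto simp: l_def w0)
  \<comment> \<open>The third vector may start in the plane of the first two, so at t = 0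
    distinctness comes from injectivity of \<open>x\<close>, which covers index 3 only if n = 3. For
    t > 0 the component along \<open>e3\<close> decides.\<close>
  have li3: "l i t \<noteq> l 3 t" if t: "t \<in> {0..1}" and i: "i = 1 \<or> i = 2" and n3: "n = 3" for i t
  proof
    assume eq: "l i t = l 3 t"
    show False
    proof (cases "t = 0")
      case True
      then have "x i = x 3" using eq l03[of i] l03[of 3] i by auto
      then show False using inj_onD[OF x, of i 3] i n3 by auto
    next
      case False
      have i1: "i \<ge> 1" "(3::nat) \<ge> 1" using i by auto
      obtain c where c: "w 3 t = c *\<^sub>R w i t"
        using abs_rp2_normalize_eq[OF wn[OF t i1(1)] wn[OF t i1(2)]] eq unfolding l_def by metis
      moreover have "e3 \<bullet> w i t = 0" using z2 i by auto
      ultimately show False using pos3[OF t, of 3] t False by simp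
    qed
  qed
  define \<gamma> where "\<gamma> t = restrict (\<lambda>i. l i t) {1..n}" for t
  have wc: "continuous_on {0..1} (\<lambda>t. w i t /\<^sub>R norm (w i t))" if "i \<ge> 1" for i
  proof -
    have "continuous_on {0..1} (w i)" unfolding w_def by (intro continuous_intros)
    then show ?thesis
      using wn that by (intro continuous_on_scaleR continuous_on_inverse continuous_on_norm) auto
  qed
  have wi: "(\<lambda>t. w i t /\<^sub>R norm (w i t)) ` {0..1} \<subseteq> sphere 0 1" if "i \<ge> 1" for i
    using wn that by auto
  have lc: "continuous_on {0..1} (l i)" if "i \<ge> 1" for i
    unfolding l_def by (rule continuous_on_compose2[OF continuous_on_abs_rp2 wc wi]) (use that in auto)
  have "continuous_on {0..1} (\<lambda>t. \<gamma> t i)" for i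
    using lc by (cases "i \<in> {1..n}") (simp_all add: \<gamma>_def restrict_def del: atLeastAtMost_iff, simp)
  then have "path \<gamma>"
    unfolding path_def by (rule continuous_on_coordinatewise_then_product)
  moreover have "\<gamma> t \<in> config_space n UNIV" if "t \<in> {0..1}" for t
  proof -
    have "inj_on (\<lambda>i. l i t) {1..n}"
    proof (rule inj_onI)
      fix i j assume ij: "i \<in> {1..n}" "j \<in> {1..n}" "l i t = l j t"
      then have "i = 1 \<or> i = 2 \<or> i = 3 \<and> n = 3" "j = 1 \<or> j = 2 \<or> j = 3 \<and> n = 3"
        using n by auto
      then show "i = j"
        using l12[OF that] li3[OF that, of 1] li3[OF that, of 2] ij(3) by metis
    qed
    then show ?thesis
      unfolding config_space_def \<gamma>_def by (auto simp: inj_on_restrict_eq)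
  qed
  then have "path_image \<gamma> \<subseteq> config_space n UNIV" by (auto simp: path_image_def)
  moreover have "pathstart \<gamma> = restrict x {1..n}"
    unfolding pathstart_def \<gamma>_def using l03 n by (intro restrict_ext) auto
  moreover have "pathfinish \<gamma> = frame_config n q"
    unfolding pathfinish_def \<gamma>_def frame_config_def
    using norm_frame[OF q(1)] e3 n by (intro restrict_ext) (auto simp: l_def w_def e_def)
  moreover have pl: "path_lift (\<lambda>t. \<gamma> t i) (w i 0 /\<^sub>R norm (w i 0)) (w i 1 /\<^sub>R norm (w i 1))" if
    "i \<in> {1..n}" for i
  proof -
    have "path_lift (\<lambda>t. \<gamma> t i) (pathstart (\<lambda>t. w i t /\<^sub>R norm (w i t))) (pathfinish (\<lambda>t. w i t /\<^sub>R norm (w i t)))"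
      using that wc[of i] wi[of i]
      by (intro path_liftI) (simp_all add: path_def path_image_def \<gamma>_def l_def)
    then show ?thesis by (simp add: pathstart_def pathfinish_def)
  qed
  moreover have "w 1 1 = frame1 q" "w 2 1 = frame2 q" by (simp_all add: w_def e_def)
  ultimately show ?thesis
    using that[OF q(1), of \<gamma>] pl[of 1] pl[of 2] norm_frame[OF q(1)] n by force
qed

section \<open>Quaternion loops at an arbitrary base configuration\<close>

lemma conj_path_coordinate: "(\<lambda>t. conj_path g p t i) = (\<lambda>t. g t i) +++ ((\<lambda>t. p t i)
  +++ reversepath (\<lambda>t. g t i))"
  by (auto simp: conj_path_def joinpaths_def reversepath_def)

text \<open>The return along \<open>g\<close> is lifted by the reversed lift if \<open>p\<close>
  closes up at \<open>v\<close>, and by its antipode otherwise; the whole lift ends at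
  \<open>u\<close> or at \<open>- u\<close> accordingly.\<close>

lemma closed_strand_conj_path:
  assumes g: "path_lift (\<lambda>t. g t i) u v" and p: "path_lift (\<lambda>t. p t i) v w" and w: "w = v \<or> w = - v"
  shows "closed_strand (conj_path g p) i \<longleftrightarrow> w = v"
proof -
  note r = path_lift_reverse[OF g]
  have nz: "v \<noteq> - v"
  proof
    assume "v = - v"
    then have "2 * v = 0" by (simp add: vec_eq_iff)
    then have "v = 0" by (simp add: vec_eq_iff)
    then show False using path_lift_norm(2)[OF g] by simp
  qed
  have nzu: "u \<noteq> - u"
  proof
    assume "u = - u"
    then have "2 * u = 0" by (simp add: vec_eq_iff)
    then have "u = 0" by (simp add: vec_eq_iff)
    then show False using path_lift_norm(1)[OF g] by simp
  qed
  show ?thesis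
    using w
  proof
    assume "w = v"
    then show ?thesis
      unfolding closed_strand_def conj_path_coordinate
      using closed_lift_iff[OF path_lift_join[OF g path_lift_join[OF p]]] r by blast
  next
    assume "w = - v"
    then show ?thesis
      unfolding closed_strand_def conj_path_coordinate
      using closed_lift_iff[OF path_lift_join[OF g path_lift_join[OF p]]] path_lift_uminus[OF r] nz
        nzu by blast
  qed
qed

lemma quaternion_loops:
  assumes n: "n = 2 \<or> n = 3" and x: "inj_on x {1..n}"
  obtains a b where "a \<in> loops_at (config_space n UNIV) (restrict x {1..n})"
    "b \<in> loops_at (config_space n UNIV) (restrict x {1..n})"
    "homotopic_paths (config_space n UNIV) (a +++ a) (b +++ b)"
    "homotopic_paths (config_space n UNIV) (a +++ a) ((a +++ b) +++ (a +++ b))"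
    "closed_strand a 1" "\<not> closed_strand a 2" "\<not> closed_strand b 1" "closed_strand b 2"
proof -
  let ?C = "config_space n UNIV :: (nat \<Rightarrow> rp2) set"
  obtain q \<gamma> u v where q: "norm q = 1" and g: "path \<gamma>" "path_image \<gamma> \<subseteq> ?C"
    and gs: "pathstart \<gamma> = restrict x {1..n}" "pathfinish \<gamma> = frame_config n q"
    and gl: "path_lift (\<lambda>t. \<gamma> t 1) u (frame1 q)" "path_lift (\<lambda>t. \<gamma> t 2) v (frame2 q)"
    using path_to_frame_config[OF n x] by metis
  have n3: "n \<le> 3" "n \<ge> 2" using n by auto
  \<comment> \<open>A path from \<open>q\<close> to \<open>h q\<close> projects to a loop because
    \<open>h\<close> preserves the configuration. For \<open>quat_i\<close> and
    \<open>quat_j\<close> these loops are, up to homotopy, the half-turns about the first and the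
    second axis.\<close>
  have ex: "\<exists>p. path p \<and> path_image p \<subseteq> ?C \<and> pathstart p = frame_config n q \<and> pathfinish p
    = frame_config n q \<and> frame_lift n p q (h q)"
    if h: "h \<in> frame_deck" for h
  proof -
    have "path_connected (sphere 0 1 :: (real^4) set)"
      by (intro path_connected_sphere) simp
    then obtain r where r: "path r" "path_image r \<subseteq> sphere 0 1" "pathstart r = q" "pathfinish r = h q"
      using q frame_deck_norm[OF h] unfolding path_connected_def by (metis mem_sphere_0)
    have "path (frame_config n \<circ> r)"
      using r(1,2) by (meson continuous_on_frame_config continuous_on_subset path_continuous_image)
    moreover have "path_image (frame_config n \<circ> r) \<subseteq> ?C"
      using r(2) frame_config_in[OF n3(1)] unfolding path_image_compose by auto
    moreover have "frame_lift n (frame_config n \<circ> r) q (h q)"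
      unfolding frame_lift_def using r by (intro exI[of _ r]) simp
    ultimately show ?thesis
      using r(3,4) frame_config_deck[OF h q] by (intro exI[of _ "frame_config n \<circ> r"]) (simp
        add: pathstart_compose pathfinish_compose)
  qed
  have d: "(\<lambda>q. quat_i q) \<in> frame_deck" "(\<lambda>q. quat_j q) \<in> frame_deck"
    "(\<lambda>q. quat_i (quat_j q)) \<in> frame_deck"
    by (simp_all add: frame_deck_def)
  obtain a where a: "path a" "path_image a \<subseteq> ?C" "pathstart a = frame_config n q"
    "pathfinish a = frame_config n q"
    "frame_lift n a q (quat_i q)" using ex[OF d(1)] by blast
  obtain b where b: "path b" "path_image b \<subseteq> ?C" "pathstart b = frame_config n q"
    "pathfinish b = frame_config n q"
    "frame_lift n b q (quat_j q)" using ex[OF d(2)] by blast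
  have aa: "frame_lift n (a +++ a) q (- q)"
    using frame_lift_join[OF a(5) frame_lift_deck[OF a(5) d(1)]] by simp
  have bb: "frame_lift n (b +++ b) q (- q)"
    using frame_lift_join[OF b(5) frame_lift_deck[OF b(5) d(2)]] by simp
  \<comment> \<open>The lift of \<open>b\<close> must start at \<open>quat_i q\<close>, so it is
    translated by \<open>quat_i\<close>. The resulting transformation again squares to -1, exactly
    as \<open>quat_i\<close> and \<open>quat_j\<close> do.\<close>
  have ab: "frame_lift n (a +++ b) q (quat_i (quat_j q))"
    using frame_lift_join[OF a(5) frame_lift_deck[OF b(5) d(1)]] by simp
  have abab: "frame_lift n ((a +++ b) +++ (a +++ b)) q (- q)"
    using frame_lift_join[OF ab frame_lift_deck[OF ab d(3)]] by simp
  note h1 = frame_lift_homotopic[OF n3(1) aa bb] and h2 = frame_lift_homotopic[OF n3(1) aa abab]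
  let ?a = "conj_path \<gamma> a" and ?b = "conj_path \<gamma> b"
  have J: "homotopic_paths ?C (conj_path \<gamma> p +++ conj_path \<gamma> r) (conj_path \<gamma> (p +++ r))"
    if "path p" "path_image p \<subseteq> ?C" "pathstart p = frame_config n q" "pathfinish p = frame_config n q"
      "path r" "path_image r \<subseteq> ?C" "pathstart r = frame_config n q"
        "pathfinish r = frame_config n q" for p r
    using conj_path_join[OF g] that gs by simp
  have K: "homotopic_paths ?C (conj_path \<gamma> p) (conj_path \<gamma> r)"
    if "homotopic_paths ?C p r" "pathstart p = frame_config n q" "pathfinish p = frame_config n q"
      for p r
    using conj_path_cong[OF g that(1)] that gs by simp
  have loop: "conj_path \<gamma> p \<in> loops_at ?C (restrict x {1..n})"
    if "path p" "path_image p \<subseteq> ?C" "pathstart p = frame_config n q"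
      "pathfinish p = frame_config n q" for p
    using that g gs by (auto simp: conj_path_def loops_at_def subset_path_image_join)
  have Jaa: "homotopic_paths ?C (?a +++ ?a) (conj_path \<gamma> (a +++ a))" by (rule J) (use a in auto)
  have Jbb: "homotopic_paths ?C (?b +++ ?b) (conj_path \<gamma> (b +++ b))" by (rule J) (use b in auto)
  have Jab: "homotopic_paths ?C (?a +++ ?b) (conj_path \<gamma> (a +++ b))" by (rule J) (use a b in auto)
  have Jabab: "homotopic_paths ?C (conj_path \<gamma> (a +++ b) +++ conj_path \<gamma> (a +++ b)) (conj_path \<gamma> ((a
    +++ b) +++ (a +++ b)))"
    by (rule J) (use a b in \<open>auto simp: subset_path_image_join\<close>)
  have la: "?a \<in> loops_at ?C (restrict x {1..n})" by (rule loop[OF a(1-4)])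
  have lb: "?b \<in> loops_at ?C (restrict x {1..n})" by (rule loop[OF b(1-4)])
  have Jab2: "homotopic_paths ?C ((?a +++ ?b) +++ (?a +++ ?b)) (conj_path \<gamma> (a +++ b)
    +++ conj_path \<gamma> (a +++ b))"
    using la lb by (intro homotopic_paths_join[OF Jab Jab]) (auto simp: loops_at_def)
  have R1: "homotopic_paths ?C (?a +++ ?a) (?b +++ ?b)"
    using homotopic_paths_trans[OF Jaa homotopic_paths_trans[OF K[OF h1] homotopic_paths_sym[OF
      Jbb]]] a by simp
  have "homotopic_paths ?C (conj_path \<gamma> (a +++ a)) (conj_path \<gamma> ((a +++ b) +++ (a +++ b)))"
    by (rule K[OF h2]) (use a in auto)
  then have R2: "homotopic_paths ?C (?a +++ ?a) ((?a +++ ?b) +++ (?a +++ ?b))"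
    using homotopic_paths_trans[OF Jaa] homotopic_paths_sym[OF homotopic_paths_trans[OF Jab2 Jabab]]
      homotopic_paths_trans by blast
  have ne: "- frame1 q \<noteq> frame1 q" "- frame2 q \<noteq> frame2 q"
  proof -
    have "- f \<noteq> f" if "norm f = 1" for f :: "real^3"
    proof
      assume "- f = f"
      then have "f = 0" by (simp add: vec_eq_iff)
      then show False using that by simp
    qed
    then show "- frame1 q \<noteq> frame1 q" "- frame2 q \<noteq> frame2 q" using norm_frame[OF q] by blast+
  qed
  have "closed_strand ?a 1" "\<not> closed_strand ?a 2"
    using closed_strand_conj_path[where g = \<gamma> and p = a and i = 1, OF gl(1) path_lift_strand(1)[OF
      a(5) n3(2)]]
      closed_strand_conj_path[where g = \<gamma> and p = a and i = 2, OF gl(2) path_lift_strand(2)[OF a(5)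
        n3(2)]] ne by simp_all
  moreover have "\<not> closed_strand ?b 1" "closed_strand ?b 2"
    using closed_strand_conj_path[where g = \<gamma> and p = b and i = 1, OF gl(1) path_lift_strand(1)[OF
      b(5) n3(2)]]
      closed_strand_conj_path[where g = \<gamma> and p = b and i = 2, OF gl(2) path_lift_strand(2)[OF b(5)
        n3(2)]] ne by simp_all
  ultimately show ?thesis using that[OF la lb R1 R2] by blast
qed

section \<open>Transporting the quaternion relations along a section\<close>

theorem theorem3:
  fixes n m :: nat and x :: "nat \<Rightarrow> rp2"
  assumes "n = 2 \<or> n = 3" and "m \<ge> 4" and "inj_on x {1..m}"
  shows "\<not> (\<exists>s \<in> hom (pure_braid_group n (UNIV :: rp2 set) x) (pure_braid_group m (UNIV :: rp2 set) x).
            \<forall>c \<in> carrier (pure_braid_group n (UNIV :: rp2 set) x).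
              forget_strands n (UNIV :: rp2 set) (s c) = c)"
proof
  let ?C = "\<lambda>n. config_space n UNIV :: (nat \<Rightarrow> rp2) set"
  let ?x = "\<lambda>n. restrict x {1..n}"
  assume "\<exists>s \<in> hom (pure_braid_group n (UNIV :: rp2 set) x) (pure_braid_group m (UNIV :: rp2 set) x).
            \<forall>c \<in> carrier (pure_braid_group n (UNIV :: rp2 set) x).
              forget_strands n (UNIV :: rp2 set) (s c) = c"
  then obtain s where s: "s \<in> hom (fundamental_group (?C n) (?x n)) (fundamental_group (?C m) (?x m))"
    and sec: "\<And>c. c \<in> carrier (fundamental_group (?C n) (?x n))
      \<Longrightarrow> induced_map (?C n) (\<lambda>f. restrict f {1..n}) (s c) = c"
    unfolding pure_braid_group_def forget_strands_def by blast
  have xn: "inj_on x {1..n}" by (rule inj_on_subset[OF assms(3)]) (use assms in auto)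
  obtain a b where a: "a \<in> loops_at (?C n) (?x n)" and b: "b \<in> loops_at (?C n) (?x n)"
    and ab: "homotopic_paths (?C n) (a +++ a) (b +++ b)"
    and ac: "homotopic_paths (?C n) (a +++ a) ((a +++ b) +++ (a +++ b))"
    and sa: "closed_strand a 1" "\<not> closed_strand a 2" and sb: "\<not> closed_strand b 1" "closed_strand b 2"
    using quaternion_loops[OF assms(1) xn] by blast
  have lift: "\<exists>p\<in>loops_at (?C m) (?x m). s (path_class (?C n) c) = path_class (?C m) p"
    if "c \<in> loops_at (?C n) (?x n)" for c
    using hom_in_carrier[OF s, of "path_class (?C n) c"] that unfolding carrier_fundamental_group by
      blast
  obtain A where A: "A \<in> loops_at (?C m) (?x m)" "s (path_class (?C n) a) = path_class (?C m) A"
    using lift[OF a] by blast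
  obtain B where B: "B \<in> loops_at (?C m) (?x m)" "s (path_class (?C n) b) = path_class (?C m) B"
    using lift[OF b] by blast
  have mult: "s (path_class (?C n) (p +++ r)) = path_class (?C m) (P +++ R)"
    if "p \<in> loops_at (?C n) (?x n)" "r \<in> loops_at (?C n) (?x n)" "P \<in> loops_at (?C m) (?x m)"
      "R \<in> loops_at (?C m) (?x m)"
      "s (path_class (?C n) p) = path_class (?C m) P" "s (path_class (?C n) r)
        = path_class (?C m) R" for p r P R
    using hom_mult[OF s, of "path_class (?C n) p" "path_class (?C n) r"] that
    by (simp add: mult_path_class carrier_fundamental_group)
  have hom: "homotopic_paths (?C m) P R"
    if "homotopic_paths (?C n) p r" "P \<in> loops_at (?C m) (?x m)"
      "s (path_class (?C n) p) = path_class (?C m) P" "s (path_class (?C n) r)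
        = path_class (?C m) R" for p r P R
  proof -
    have "path_class (?C n) p = path_class (?C n) r"
      using that(1) homotopic_paths_imp_path[OF that(1)] homotopic_paths_imp_subset[OF that(1)] by
        (simp add: path_class_eq_iff)
    then show ?thesis
      using that(2-4) path_class_eq_iff[of P "?C m" R] by (simp add: loops_at_def)
  qed
  note AB = join_loops_at[OF A(1) B(1)] and AA = join_loops_at[OF A(1) A(1)]
  note mab = mult[OF a b A(1) B(1) A(2) B(2)]
  have h1: "homotopic_paths (?C m) (A +++ A) (B +++ B)"
    by (rule hom[OF ab AA mult[OF a a A(1) A(1) A(2) A(2)] mult[OF b b B(1) B(1) B(2) B(2)]])
  have h2: "homotopic_paths (?C m) (A +++ A) ((A +++ B) +++ (A +++ B))"
    by (rule hom[OF ac AA mult[OF a a A(1) A(1) A(2) A(2)] mult[OF join_loops_at[OF a b]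
      join_loops_at[OF a b] AB AB mab mab]])
  \<comment> \<open>The section property makes the first n strands of \<open>P\<close> homotopic to
    \<open>p\<close>; projecting further to strands 1 and 2 shows that the signs there
    agree.\<close>
  have signs: "closed_strand P 1 \<longleftrightarrow> closed_strand p 1" "closed_strand P 2 \<longleftrightarrow> closed_strand p 2"
    if p: "p \<in> loops_at (?C n) (?x n)" and P: "P \<in> loops_at (?C m) (?x m)" and
      sp: "s (path_class (?C n) p) = path_class (?C m) P" for p P
  proof -
    have "path_class (?C n) p \<in> carrier (fundamental_group (?C n) (?x n))"
      using p by (simp add: carrier_fundamental_group)
    from sec[OF this] sp have eq: "induced_map (?C n) (\<lambda>f. restrict f {1..n}) (path_class (?C m) P)
      = path_class (?C n) p"
      by simp
    have "p \<in> path_class (?C n) p" using p by (simp add: path_class_def loops_at_def)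
    then have "p \<in> induced_map (?C n) (\<lambda>f. restrict f {1..n}) (path_class (?C m) P)" using eq by simp
    \<comment> \<open>\<open>induced_map\<close> collects the paths homotopic to the image of some
      member of the class, so a representative \<open>P'\<close> mediates between \<open>P\<close>
      and \<open>p\<close>.\<close>
    then obtain P' where P': "homotopic_paths (?C m) P P'"
      "homotopic_paths (?C n) ((\<lambda>f. restrict f {1..n}) \<circ> P') p"
      unfolding induced_map_def path_class_def by blast
    have ij: "(1::nat) \<noteq> 2" "1 \<in> {1..n}" "2 \<in> {1..n}" "1 \<in> {1..m}" "2 \<in> {1..m}" using assms by auto
    have "homotopic_paths distinct_pairs (strands 1 2 \<circ> P) (strands 1 2 \<circ> P')"
      by (rule homotopic_paths_continuous_image[OF P'(1) continuous_on_strands strands_config[OF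
        ij(1,4,5)]])
    moreover have "homotopic_paths distinct_pairs (strands 1 2 \<circ> ((\<lambda>f. restrict f {1..n}) \<circ> P')) (strands 1 2 \<circ> p)"
      by (rule homotopic_paths_continuous_image[OF P'(2) continuous_on_strands strands_config[OF
        ij(1,2,3)]])
    moreover have "strands 1 2 \<circ> ((\<lambda>f. restrict f {1..n}) \<circ> P') = strands 1 2 \<circ> P'"
      using ij by (auto simp: strands_def)
    ultimately have "homotopic_paths distinct_pairs (strands 1 2 \<circ> P) (strands 1 2 \<circ> p)"
      using homotopic_paths_trans by metis
    then have *: "homotopic_paths distinct_pairs (strands 1 2 \<circ> P) (strands 1 2 \<circ> p)"
      "homotopic_paths distinct_pairs (strands 1 2 \<circ> p) (strands 1 2 \<circ> P)"
      using homotopic_paths_sym by blast+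
    show "closed_strand P 1 \<longleftrightarrow> closed_strand p 1"
      using closed_lift_fst_homotopic[OF *(1)] closed_lift_fst_homotopic[OF *(2)]
      unfolding closed_strand_fst by blast
    show "closed_strand P 2 \<longleftrightarrow> closed_strand p 2"
      using closed_lift_snd_homotopic[OF *(1)] closed_lift_snd_homotopic[OF *(2)]
      unfolding closed_strand_snd by blast
  qed
  show False
    using no_quaternion_loops[OF assms(2) A(1) B(1) h1 h2] signs[OF a A] signs[OF b B] sa sb by blast
qed

end
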